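(* Let $W\subset Y\times\mathbb{C}$ be a Worm, and let $k_W$ be its Kobayashi distance. Then the metric space $(W,k_W)$ is not Gromov hyperbolic.
   Context: **Worms.** Let $I,J\subset\mathbb{R}$ be compact intervals with nonempty interior such that $I\subset J^\circ$. Let $\eta:\mathbb{R}\to[0,+\infty)$ be any smooth function such that: (1) $\eta$ vanishes identically on $I$; (2) on $\mathbb{R}\setminus I$ the function $\eta$ is real-analytic and satisfies $\eta''>0$ (in particular $\eta>0$ and $\eta'\neq0$ on $\mathbb{R}\setminus I$); (3) $J=\{\eta\le 1\}$. Let $Y$ be an open (i.e. connected, non-compact) Riemann surface with a smooth function $\theta:Y\to\mathbb{R}$ such that: (a) $\theta$ has no critical point $z$ with $\theta(z)\in\partial I$ or $\theta(z)\in\partial J$; (b) $\theta^{-1}(J)$ is a compact subset of $Y$. Define $$W:=\{(z,w)\in Y\times\mathbb{C}: |w-e^{i\theta(z)}|^2<1-\eta(\theta(z))\},$$ which is understood to be a domain (nonempty and connected). If moreover $\theta$ is harmonic, $W$ is called a *Worm*. **Gromov hyperbolicity.** In a metric space $(X,d)$ the Gromov product is $(x|y)_o:=\frac12[d(x,o)+d(y,o)-d(x,y)]$. The space is Gromov hyperbolic if there is $\delta\ge0$ such that $(x|y)_o\ge\min\{(x|z)_o,(y|z)_o\}-\delta$ for all $x,y,z,o\in X$. *)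

theory Defs
  imports "HOL-Complex_Analysis.Complex_Analysis"
begin

section \<open>Smooth and real-analytic functions\<close>

text \<open>For open \<open>S\<close> this is the usual class $C^k(S)$: the iterated directional derivatives
  of order less than \<open>k\<close> are Frechet differentiable, and those of order \<open>k\<close> are continuous.\<close>

primrec Ck_on ::
  "nat \<Rightarrow> 'a::real_normed_vector set \<Rightarrow> ('a \<Rightarrow> 'b::real_normed_vector) \<Rightarrow> bool" where
  "Ck_on 0 S f \<longleftrightarrow> continuous_on S f"
| "Ck_on (Suc k) S f \<longleftrightarrow>
     (\<forall>x\<in>S. f differentiable (at x)) \<and> (\<forall>v. Ck_on k S (\<lambda>x. frechet_derivative f (at x) v))"

definition smooth_on :: "'a::real_normed_vector set \<Rightarrow> ('a \<Rightarrow> 'b::real_normed_vector) \<Rightarrow> bool" where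
  "smooth_on S f \<longleftrightarrow> (\<forall>k. Ck_on k S f)"

definition real_analytic_on :: "real set \<Rightarrow> (real \<Rightarrow> real) \<Rightarrow> bool" where
  "real_analytic_on S f \<longleftrightarrow>
     (\<forall>x\<in>S. \<exists>r>0. \<exists>c. \<forall>y. \<bar>y - x\<bar> < r \<longrightarrow> (\<lambda>n. c n * (y - x) ^ n) sums f y)"

definition laplacian :: "(complex \<Rightarrow> real) \<Rightarrow> complex \<Rightarrow> real" where
  "laplacian u z =
     frechet_derivative (\<lambda>\<zeta>. frechet_derivative u (at \<zeta>) 1) (at z) 1 +
     frechet_derivative (\<lambda>\<zeta>. frechet_derivative u (at \<zeta>) \<i>) (at z) \<i>"

section \<open>Riemann surfaces\<close>

text \<open>A chart is a pair of its domain \<open>U\<close> and a coordinate \<open>\<phi>\<close>, of which only the values on \<open>U\<close>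
  matter. The surface \<open>Y\<close> is the union of the chart domains; it is an open subset of the ambient
  Hausdorff space and may be all of it. The atlas need not be maximal.\<close>

type_synonym 'a chart = "'a set \<times> ('a \<Rightarrow> complex)"

definition complex_chart :: "'a::topological_space chart \<Rightarrow> bool" where
  "complex_chart = (\<lambda>(U, \<phi>). open U \<and> open (\<phi> ` U) \<and> homeomorphism U (\<phi> ` U) \<phi> (inv_into U \<phi>))"

locale riemann_surface =
  fixes Y :: "'a::t2_space set" and \<A> :: "'a chart set"
  assumes charts: "C \<in> \<A> \<Longrightarrow> complex_chart C"
    and covers: "(\<Union>(U, \<phi>)\<in>\<A>. U) = Y"
    and compatible: "(U, \<phi>) \<in> \<A> \<Longrightarrow> (V, \<psi>) \<in> \<A> \<Longrightarrow>
           (\<psi> \<circ> inv_into U \<phi>) holomorphic_on (\<phi> ` (U \<inter> V))"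
    and nonempty: "Y \<noteq> {}"
    and connected: "connected Y"

definition smooth_fun :: "'a chart set \<Rightarrow> ('a \<Rightarrow> real) \<Rightarrow> bool" where
  "smooth_fun \<A> f \<longleftrightarrow> (\<forall>(U, \<phi>)\<in>\<A>. smooth_on (\<phi> ` U) (f \<circ> inv_into U \<phi>))"

definition critical_point :: "'a chart set \<Rightarrow> ('a \<Rightarrow> real) \<Rightarrow> 'a \<Rightarrow> bool" where
  "critical_point \<A> f z \<longleftrightarrow>
     (\<exists>(U, \<phi>)\<in>\<A>. z \<in> U \<and> frechet_derivative (f \<circ> inv_into U \<phi>) (at (\<phi> z)) = (\<lambda>_. 0))"

text \<open>Harmonicity is independent of the charts because the transition maps are conformal.\<close>

definition harmonic_fun :: "'a chart set \<Rightarrow> ('a \<Rightarrow> real) \<Rightarrow> bool" where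
  "harmonic_fun \<A> f \<longleftrightarrow>
     (\<forall>(U, \<phi>)\<in>\<A>. Ck_on 2 (\<phi> ` U) (f \<circ> inv_into U \<phi>) \<and>
        (\<forall>\<zeta>\<in>\<phi> ` U. laplacian (f \<circ> inv_into U \<phi>) \<zeta> = 0))"

section \<open>Kobayashi distance\<close>

text \<open>Holomorphic maps from the unit disc into a domain \<open>W\<close> of the product of the surface with the
  complex plane. In the charts $\varphi \times \mathrm{id}$ of the product, holomorphy is holomorphy
  of both components. Continuity makes the set on which a chart can be applied open.\<close>

definition holomorphic_disc ::
  "'a::topological_space chart set \<Rightarrow> ('a \<times> complex) set \<Rightarrow> (complex \<Rightarrow> 'a \<times> complex) \<Rightarrow> bool" where
  "holomorphic_disc \<A> W f \<longleftrightarrow>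
     f ` ball 0 1 \<subseteq> W \<and>
     continuous_on (ball 0 1) f \<and>
     (\<forall>(U, \<phi>)\<in>\<A>. (\<lambda>\<zeta>. \<phi> (fst (f \<zeta>))) holomorphic_on {\<zeta>\<in>ball 0 1. fst (f \<zeta>) \<in> U}) \<and>
     (\<lambda>\<zeta>. snd (f \<zeta>)) holomorphic_on ball 0 1"

text \<open>Poincare distance of the unit disc, normalised to curvature $-4$.\<close>

definition poincare_dist :: "complex \<Rightarrow> complex \<Rightarrow> real" where
  "poincare_dist a b = artanh (cmod ((a - b) / (1 - cnj b * a)))"

text \<open>\<open>disc_chain \<A> W p q l\<close>: some finite chain of holomorphic discs in \<open>W\<close> joins \<open>p\<close> to \<open>q\<close> and has
  total Poincare length \<open>l\<close>.\<close>

inductive disc_chain ::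
  "'a::topological_space chart set \<Rightarrow> ('a \<times> complex) set \<Rightarrow>
     'a \<times> complex \<Rightarrow> 'a \<times> complex \<Rightarrow> real \<Rightarrow> bool"
  for \<A> W where
  refl: "p \<in> W \<Longrightarrow> disc_chain \<A> W p p 0"
| step: "disc_chain \<A> W p (f a) l \<Longrightarrow> holomorphic_disc \<A> W f \<Longrightarrow> a \<in> ball 0 1 \<Longrightarrow> b \<in> ball 0 1 \<Longrightarrow>
     disc_chain \<A> W p (f b) (l + poincare_dist a b)"

text \<open>The infimum is over a nonempty set of nonnegative numbers whenever \<open>p\<close> and \<open>q\<close> lie in the same
  component of the open set \<open>W\<close>, so no infinite values are needed for a domain.\<close>

definition kobayashi_dist ::
  "'a::topological_space chart set \<Rightarrow> ('a \<times> complex) set \<Rightarrow>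
     'a \<times> complex \<Rightarrow> 'a \<times> complex \<Rightarrow> real" where
  "kobayashi_dist \<A> W p q = Inf {l. disc_chain \<A> W p q l}"

section \<open>Gromov hyperbolicity\<close>

definition gromov_product :: "('b \<Rightarrow> 'b \<Rightarrow> real) \<Rightarrow> 'b \<Rightarrow> 'b \<Rightarrow> 'b \<Rightarrow> real" where
  "gromov_product d x y p = (d x p + d y p - d x y) / 2"

text \<open>That \<open>d\<close> is a metric on \<open>X\<close> is deliberately not part of this predicate, so that its negation
  always refers to the four-point inequality.\<close>

definition gromov_hyperbolic :: "'b set \<Rightarrow> ('b \<Rightarrow> 'b \<Rightarrow> real) \<Rightarrow> bool" where
  "gromov_hyperbolic X d \<longleftrightarrow>
     (\<exists>\<delta>\<ge>0. \<forall>x\<in>X. \<forall>y\<in>X. \<forall>z\<in>X. \<forall>p\<in>X.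
        gromov_product d x y p \<ge> min (gromov_product d x z p) (gromov_product d y z p) - \<delta>)"

section \<open>Worms\<close>

definition worm_domain ::
  "'a set \<Rightarrow> ('a \<Rightarrow> real) \<Rightarrow> (real \<Rightarrow> real) \<Rightarrow> ('a \<times> complex) set" where
  "worm_domain Y \<theta> \<eta> =
     {(z, w). z \<in> Y \<and> (cmod (w - exp (\<i> * complex_of_real (\<theta> z))))\<^sup>2 < 1 - \<eta> (\<theta> z)}"

locale worm = riemann_surface Y \<A>
  for Y :: "'a::t2_space set" and \<A> :: "'a chart set" +
  fixes \<theta> :: "'a \<Rightarrow> real" and \<eta> :: "real \<Rightarrow> real" and I J :: "real set"
  assumes noncompact: "\<not> compact Y"
    and I_interval: "is_interval I" "compact I" "interior I \<noteq> {}"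
    and J_interval: "is_interval J" "compact J" "interior J \<noteq> {}"
    and I_sub_J: "I \<subseteq> interior J"
    and eta_nonneg: "\<eta> x \<ge> 0"
    and eta_smooth: "smooth_on UNIV \<eta>"
    and eta_zero: "x \<in> I \<Longrightarrow> \<eta> x = 0"
    and eta_analytic: "real_analytic_on (- I) \<eta>"
    and eta_convex: "x \<notin> I \<Longrightarrow> deriv (deriv \<eta>) x > 0"
    and J_eq: "J = {x. \<eta> x \<le> 1}"
    and theta_smooth: "smooth_fun \<A> \<theta>"
    and theta_regular:
      "z \<in> Y \<Longrightarrow> \<theta> z \<in> frontier I \<union> frontier J \<Longrightarrow> \<not> critical_point \<A> \<theta> z"
    and theta_proper: "compact {z\<in>Y. \<theta> z \<in> J}"
    and theta_harmonic: "harmonic_fun \<A> \<theta>"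
    and domain_nonempty: "worm_domain Y \<theta> \<eta> \<noteq> {}"
    and domain_connected: "connected (worm_domain Y \<theta> \<eta>)"

end

theory Submission
  imports Defs
begin

text \<open>Over \<open>I\<close> the domain is \<open>\<bar>w\<bar>\<^sup>2 < 2 Re (w e\<^bsup>-i\<theta>\<^esup>)\<close>, which near \<open>w = 0\<close> looks like the product of
  the base with a half-plane, and a product of two hyperbolic directions contains large
  \<open>\<ell>\<^sup>\<infinity>\<close>-squares. By the maximum principle \<open>\<theta>\<close> attains \<open>b = max I\<close>, at a regular point. There
  \<open>\<theta>\<close> is the real part of a coordinate \<open>\<zeta>\<close>, and with \<open>w = e\<^bsup>i\<zeta>\<^esup> / \<omega>\<close> the worm contains a disc tangent
  to \<open>Re \<zeta> = b\<close> times the half-plane \<open>Re \<omega> > 3/2\<close>. Along the geodesics \<open>s\<close> of the disc (towards \<open>b\<close>)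
  and \<open>t\<close> of the half-plane (\<open>\<omega>\<close> on a half circle of radius \<open>R\<close>) take the points
  \<open>(s, t) = (-T, 0), (T, 0), (0, T), (0, -T)\<close> with \<open>T = tanh N\<close>. The four sides of this
  square have length at most \<open>N\<close>, by explicit discs.

  The diagonals are long, for \<open>R\<close> large. For one of them: \<open>arg w - \<theta>\<close> is pluriharmonic on the whole
  worm with values in \<open>(-\<pi>/2, \<pi>/2)\<close>, so Schwarz's lemma gives about \<open>2 N\<close>. For the other: \<open>log (2/\<bar>w\<bar>)\<close>
  is positive and pluriharmonic, so by Harnack a chain of bounded length starting at a tiny \<open>\<bar>w\<bar>\<close> keeps \<open>\<bar>w\<bar>\<close>
  tiny, even on large parts of its discs. As \<open>\<eta>(\<theta>) < 2 \<bar>w\<bar>\<close>, this forces \<open>\<theta> < B\<close> there for a \<open>B\<close> barely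
  above \<open>b\<close>, and Harnack for \<open>B - \<theta>\<close> gives a length of about \<open>N/2\<close>. Since \<open>2 N + N/2\<close> exceeds \<open>2 N\<close>
  by an arbitrarily large amount, the four-point condition fails.\<close>

section \<open>Schwarz and Harnack inequalities on the disc\<close>

lemma artanh_le_artanh:
  fixes x y :: real
  assumes "0 \<le> x" "x \<le> y" "y < 1"
  shows "artanh x \<le> artanh y"
proof -
  have "(1 + x) / (1 - x) \<le> (1 + y) / (1 - y)"
    using assms by (intro frac_le) auto
  moreover have "0 < (1 + x) / (1 - x)"
    using assms by auto
  ultimately show ?thesis
    unfolding artanh_def by simp
qed

lemma artanh_nonneg:
  fixes x :: real
  assumes "0 \<le> x" "x < 1"
  shows "0 \<le> artanh x"
  using artanh_le_artanh[of 0 x] assms by simp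

text \<open>After exponentiation this is \<open>(1 + 3 * t) * (1 - t) \<le> (1 + t)^2\<close>. It
  bounds the cost of shrinking the unit disc to radius \<open>(1 + t) / 2\<close>: the distance from
  0 to a point of modulus \<open>t\<close> at most doubles.\<close>

lemma artanh_double_le:
  fixes t :: real
  assumes "0 \<le> t" "t < 1"
  shows "artanh (t / ((1 + t) / 2)) \<le> 2 * artanh t"
proof -
  have "(1 + t / ((1 + t) / 2)) / (1 - t / ((1 + t) / 2)) = (1 + 3 * t) / (1 - t)"
    using assms by (simp add: divide_simps)
  also have "\<dots> \<le> ((1 + t) / (1 - t))\<^sup>2"
  proof -
    have "(1 + 3 * t) * (1 - t) \<le> (1 + t)\<^sup>2"
      by (simp add: power2_eq_square algebra_simps)
    then show ?thesis
      using assms by (simp add: divide_simps power2_eq_square mult_ac)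
  qed
  finally have "ln ((1 + t / ((1 + t) / 2)) / (1 - t / ((1 + t) / 2))) \<le> ln (((1 + t) / (1 - t))\<^sup>2)"
    using assms \<open>_ = (1 + 3 * t) / (1 - t)\<close> by (intro ln_mono) auto
  also have "\<dots> = 2 * ln ((1 + t) / (1 - t))"
    using assms by (simp add: ln_realpow)
  finally show ?thesis
    unfolding artanh_def by linarith
qed

lemma exp_two_artanh:
  fixes t :: real
  assumes "0 \<le> t" "t < 1"
  shows "exp (2 * artanh t) = (1 + t) / (1 - t)"
proof -
  have "(1 + t) / (1 - t) > 0"
    using assms by simp
  then show ?thesis
    by (simp add: artanh_def)
qed

lemma cosh_two_artanh:
  fixes t :: real
  assumes "0 \<le> t" "t < 1"
  shows "cosh (2 * artanh t) = (1 + t\<^sup>2) / (1 - t\<^sup>2)"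
proof -
  have "(1 + t) / (1 - t) > 0" "1 - t\<^sup>2 = (1 - t) * (1 + t)"
    using assms by (auto simp: power2_eq_square algebra_simps)
  then show ?thesis
    using assms by (simp add: artanh_def cosh_ln_real) (simp add: divide_simps power2_eq_square algebra_simps)
qed

lemma abs_le_of_cosh_le:
  fixes x y :: real
  assumes "cosh x \<le> cosh y" "0 \<le> y"
  shows "\<bar>x\<bar> \<le> y"
  using assms cosh_real_nonneg_le_iff[of "\<bar>x\<bar>" y] by simp

text \<open>The Schwarz lemma for \<open>\<Omega>\<close> followed by the Cayley transform that
  sends \<open>\<Omega> 0\<close> to 0. The left-hand side is cosh of the distance from
  \<open>\<Omega> c\<close> to \<open>\<Omega> 0\<close> in the right half-plane of curvature -1,
  whence the factor 2 before \<open>artanh\<close>.\<close>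

lemma Schwarz_half_plane:
  assumes hol: "\<Omega> holomorphic_on ball 0 1"
    and pos: "\<And>z. z \<in> ball 0 1 \<Longrightarrow> 0 < Re (\<Omega> z)"
    and c: "cmod c < 1"
  shows "((cmod (\<Omega> c))\<^sup>2 + (cmod (\<Omega> 0))\<^sup>2 - 2 * Im (\<Omega> c) * Im (\<Omega> 0)) / (2 * Re (\<Omega> c) * Re (\<Omega> 0))
    \<le> cosh (2 * artanh (cmod c))"
proof -
  define f where "f z = (\<Omega> z - \<Omega> 0) / (\<Omega> z + cnj (\<Omega> 0))" for z
  have pos0: "0 < Re (\<Omega> 0)"
    by (intro pos) auto
  have nz: "\<Omega> z + cnj (\<Omega> 0) \<noteq> 0" if "z \<in> ball 0 1" for z
    using pos[OF that] pos0 by (auto simp: complex_eq_iff)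
  have diff: "(cmod (\<Omega> z + cnj (\<Omega> 0)))\<^sup>2 - (cmod (\<Omega> z - \<Omega> 0))\<^sup>2 = 4 * Re (\<Omega> z) * Re (\<Omega> 0)" for z
    by (simp add: cmod_power2) (simp add: power2_eq_square algebra_simps)
  have holf: "f holomorphic_on ball 0 1"
    unfolding f_def using nz by (intro holomorphic_intros hol) auto
  have f1: "cmod (f z) < 1" if "cmod z < 1" for z
  proof -
    have z: "z \<in> ball 0 1"
      using that by simp
    have "0 < 4 * Re (\<Omega> z) * Re (\<Omega> 0)"
      using pos[OF z] pos0 by simp
    then have "(cmod (\<Omega> z - \<Omega> 0))\<^sup>2 < (cmod (\<Omega> z + cnj (\<Omega> 0)))\<^sup>2"
      unfolding diff[of z, symmetric] by simp
    then have "cmod (\<Omega> z - \<Omega> 0) < cmod (\<Omega> z + cnj (\<Omega> 0))"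
      using power_less_imp_less_base by fastforce
    then show ?thesis
      by (auto simp: f_def norm_divide divide_simps)
  qed
  have f0: "f 0 = 0"
    by (simp add: f_def)
  have "cmod (f c) \<le> cmod c"
    using Schwarz_Lemma(1)[OF holf f0 f1 c] .
  then have "cmod (\<Omega> c - \<Omega> 0) \<le> cmod c * cmod (\<Omega> c + cnj (\<Omega> 0))"
    using nz[of c] c by (auto simp: f_def norm_divide divide_simps)
  then have sq: "(cmod (\<Omega> c - \<Omega> 0))\<^sup>2 \<le> (cmod c)\<^sup>2 * (cmod (\<Omega> c + cnj (\<Omega> 0)))\<^sup>2"
    by (metis norm_ge_zero power_mono power_mult_distrib)
  \<comment> \<open>The left-hand side equals \<open>(A + B) / (B - A)\<close>, which increases with
    \<open>A / B\<close>, and the Schwarz lemma says \<open>A / B \<le> |c|^2\<close>.\<close>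
  define A B X where "A = (cmod (\<Omega> c - \<Omega> 0))\<^sup>2" and "B = (cmod (\<Omega> c + cnj (\<Omega> 0)))\<^sup>2"
    and "X = Re (\<Omega> c) * Re (\<Omega> 0)"
  have X: "X > 0" "B - A = 4 * X"
    using pos[of c] pos0 c diff[of c] by (auto simp: X_def A_def B_def)
  have c2: "(cmod c)\<^sup>2 < 1"
    using c by (simp add: power_less_one_iff)
  define M where "M = (cmod (\<Omega> c))\<^sup>2 + (cmod (\<Omega> 0))\<^sup>2 - 2 * Im (\<Omega> c) * Im (\<Omega> 0)"
  have "A + B = 2 * M"
    unfolding A_def B_def M_def by (simp add: cmod_power2) (simp add: power2_eq_square algebra_simps)
  then have "M / (2 * Re (\<Omega> c) * Re (\<Omega> 0)) = (A + B) / (4 * X)"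
    by (simp add: X_def)
  also have "\<dots> \<le> (1 + (cmod c)\<^sup>2) / (1 - (cmod c)\<^sup>2)"
  proof -
    have "(A + B) * (1 - (cmod c)\<^sup>2) \<le> (1 + (cmod c)\<^sup>2) * (B - A)"
      using sq unfolding A_def[symmetric] B_def[symmetric] by (simp add: algebra_simps)
    then show ?thesis
      using X c2 by (simp add: divide_simps mult.commute)
  qed
  also have "\<dots> = cosh (2 * artanh (cmod c))"
    using c by (simp add: cosh_two_artanh)
  finally show ?thesis
    by (simp add: M_def)
qed

text \<open>Points with given real parts are closest when their imaginary parts agree, and then cosh
  of their distance is cosh of the difference of the logarithms.\<close>

lemma Harnack_disc:
  assumes hol: "\<Omega> holomorphic_on ball 0 1"
    and pos: "\<And>z. z \<in> ball 0 1 \<Longrightarrow> 0 < Re (\<Omega> z)"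
    and c: "cmod c < 1"
  shows "\<bar>ln (Re (\<Omega> c)) - ln (Re (\<Omega> 0))\<bar> \<le> 2 * artanh (cmod c)"
proof (rule abs_le_of_cosh_le)
  define X X0 where "X = Re (\<Omega> c)" and "X0 = Re (\<Omega> 0)"
  have X: "X > 0" "X0 > 0"
    using pos[of c] pos[of 0] c by (auto simp: X_def X0_def)
  have "cosh (ln X - ln X0) = (X\<^sup>2 + X0\<^sup>2) / (2 * X * X0)"
    using X cosh_ln_real[of "X / X0"] by (simp add: ln_div field_simps power2_eq_square)
  also have "\<dots> \<le> ((cmod (\<Omega> c))\<^sup>2 + (cmod (\<Omega> 0))\<^sup>2 - 2 * Im (\<Omega> c) * Im (\<Omega> 0)) / (2 * X * X0)"
  proof (intro divide_right_mono)
    have "0 \<le> (Im (\<Omega> c) - Im (\<Omega> 0))\<^sup>2"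
      by simp
    then show "X\<^sup>2 + X0\<^sup>2 \<le> (cmod (\<Omega> c))\<^sup>2 + (cmod (\<Omega> 0))\<^sup>2 - 2 * Im (\<Omega> c) * Im (\<Omega> 0)"
      by (simp add: cmod_power2 X_def X0_def power2_diff)
  qed (use X in auto)
  also have "\<dots> \<le> cosh (2 * artanh (cmod c))"
    unfolding X_def X0_def by (rule Schwarz_half_plane[OF assms])
  finally show "cosh (ln (Re (\<Omega> c)) - ln (Re (\<Omega> 0))) \<le> cosh (2 * artanh (cmod c))"
    by (simp add: X_def X0_def)
qed (use c artanh_nonneg[of "cmod c"] in auto)

text \<open>In the half-plane, \<open>arsinh (tan u)\<close> is twice the signed hyperbolic distance from the real axis to
  the ray of argument \<open>u\<close>.\<close>

lemma argument_Schwarz: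
  assumes hol: "\<Omega> holomorphic_on ball 0 1"
    and pos: "\<And>z. z \<in> ball 0 1 \<Longrightarrow> 0 < Re (\<Omega> z)"
    and c: "cmod c < 1"
  shows "\<bar>arsinh (Im (\<Omega> c) / Re (\<Omega> c)) - arsinh (Im (\<Omega> 0) / Re (\<Omega> 0))\<bar> \<le> 2 * artanh (cmod c)"
proof (rule abs_le_of_cosh_le)
  define X X0 Y Y0 where "X = Re (\<Omega> c)" and "X0 = Re (\<Omega> 0)" and "Y = Im (\<Omega> c)" and "Y0 = Im (\<Omega> 0)"
  have X: "X > 0" "X0 > 0"
    using pos[of c] pos[of 0] c by (auto simp: X_def X0_def)
  have cosh_arsinh: "cosh (arsinh (y / x)) = sqrt (x\<^sup>2 + y\<^sup>2) / x" if "x > 0" for x y :: real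
  proof -
    have "(y / x)\<^sup>2 + 1 = (x\<^sup>2 + y\<^sup>2) / x\<^sup>2"
      using that by (simp add: field_simps)
    then show ?thesis
      using that by (simp add: cosh_arsinh_real real_sqrt_divide)
  qed
  have n: "cmod (\<Omega> c) = sqrt (X\<^sup>2 + Y\<^sup>2)" "cmod (\<Omega> 0) = sqrt (X0\<^sup>2 + Y0\<^sup>2)"
    by (auto simp: cmod_def X_def X0_def Y_def Y0_def)
  have "cosh (arsinh (Y / X) - arsinh (Y0 / X0))
      = cmod (\<Omega> c) / X * (cmod (\<Omega> 0) / X0) - Y / X * (Y0 / X0)"
    using X by (simp add: cosh_diff cosh_arsinh n)
  also have "\<dots> = (2 * cmod (\<Omega> c) * cmod (\<Omega> 0) - 2 * Y * Y0) / (2 * X * X0)"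
    using X by (simp add: field_simps)
  \<comment> \<open>Points on two given rays are closest when their moduli agree.\<close>
  also have "\<dots> \<le> ((cmod (\<Omega> c))\<^sup>2 + (cmod (\<Omega> 0))\<^sup>2 - 2 * Y * Y0) / (2 * X * X0)"
  proof (intro divide_right_mono)
    have "0 \<le> (cmod (\<Omega> c) - cmod (\<Omega> 0))\<^sup>2"
      by simp
    then show "2 * cmod (\<Omega> c) * cmod (\<Omega> 0) - 2 * Y * Y0 \<le> (cmod (\<Omega> c))\<^sup>2 + (cmod (\<Omega> 0))\<^sup>2 - 2 * Y * Y0"
      by (simp add: power2_diff)
  qed (use X in auto)
  also have "\<dots> \<le> cosh (2 * artanh (cmod c))"
    unfolding X_def X0_def Y_def Y0_def by (rule Schwarz_half_plane[OF assms])
  finally show "cosh (arsinh (Im (\<Omega> c) / Re (\<Omega> c)) - arsinh (Im (\<Omega> 0) / Re (\<Omega> 0)))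
      \<le> cosh (2 * artanh (cmod c))"
    by (simp add: X_def X0_def Y_def Y0_def)
qed (use c artanh_nonneg[of "cmod c"] in auto)

section \<open>Harmonic functions as real parts\<close>

text \<open>On a convex set \<open>F\<close> has a primitive. Its real part has the same
  differential as \<open>u\<close>, so the two differ by a constant, which \<open>k\<close>
  absorbs.\<close>

lemma primitive_imp_real_part:
  assumes S: "convex S" "open S"
    and hol: "F holomorphic_on S"
    and der: "\<And>z. z \<in> S \<Longrightarrow> (u has_derivative (\<lambda>v. Re (F z * v))) (at z)"
  obtains k where "k holomorphic_on S" "\<And>z. z \<in> S \<Longrightarrow> (k has_field_derivative F z) (at z)"
    "\<And>z. z \<in> S \<Longrightarrow> u z = Re (k z)"
proof -
  obtain G where G': "\<And>z. z \<in> S \<Longrightarrow> (G has_field_derivative F z) (at z within S)"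
    using holomorphic_convex_primitive'[OF S hol] by blast
  then have G: "(G has_field_derivative F z) (at z)" if "z \<in> S" for z
    using that S by (metis at_within_open)
  have "((\<lambda>z. u z - Re (G z)) has_derivative (\<lambda>v. 0)) (at z within S)" if "z \<in> S" for z
  proof -
    have "((\<lambda>z. Re (G z)) has_derivative (\<lambda>v. Re (F z * v))) (at z)"
      using G[OF that] bounded_linear.has_derivative[OF bounded_linear_Re, of G "\<lambda>v. F z * v"]
      by (simp add: has_field_derivative_def)
    from has_derivative_diff[OF der[OF that] this] show ?thesis
      by (simp add: has_derivative_at_withinI)
  qed
  then obtain c where c: "\<And>z. z \<in> S \<Longrightarrow> u z - Re (G z) = c"
    using has_derivative_zero_constant[OF S(1), of "\<lambda>z. u z - Re (G z)"] by blast
  show thesis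
  proof
    show der: "((\<lambda>z. G z + of_real c) has_field_derivative F z) (at z)" if "z \<in> S" for z
      using G[OF that] by (auto intro!: derivative_eq_intros)
    then show "(\<lambda>z. G z + of_real c) holomorphic_on S"
      by (metis S(2) holomorphic_on_open)
    show "u z = Re (G z + of_real c)" if "z \<in> S" for z
      using c[OF that] by simp
  qed
qed

text \<open>The local functions \<open>g\<close> need not agree on overlaps, but their derivatives
  do, both being \<open>u_x - i u_y\<close>. They glue to the holomorphic \<open>F\<close>, which
  has a primitive on the convex set.\<close>

lemma locally_real_part_imp_real_part:
  assumes S: "convex S" "open S"
    and loc: "\<And>z. z \<in> S \<Longrightarrow> \<exists>U g. open U \<and> z \<in> U \<and> g holomorphic_on U \<and> (\<forall>y\<in>U. u y = Re (g y))"
  obtains k where "k holomorphic_on S" "\<forall>z\<in>S. u z = Re (k z)"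
proof -
  define F where "F z = Complex (frechet_derivative u (at z) 1) (- frechet_derivative u (at z) \<i>)" for z
  have F: "F y = deriv g y" "(u has_derivative (\<lambda>v. Re (F y * v))) (at y)"
    if U: "open U" "y \<in> U" "g holomorphic_on U" "\<forall>y\<in>U. u y = Re (g y)" for U g y
  proof -
    have "(g has_field_derivative deriv g y) (at y)"
      using U holomorphic_derivI by blast
    then have "((\<lambda>z. Re (g z)) has_derivative (\<lambda>v. Re (deriv g y * v))) (at y)"
      using bounded_linear.has_derivative[OF bounded_linear_Re, of g "\<lambda>v. deriv g y * v"]
      by (simp add: has_field_derivative_def)
    then have der: "(u has_derivative (\<lambda>v. Re (deriv g y * v))) (at y)"
      using has_derivative_transform_within_open[OF _ U(1,2), of _ _ _ u] U(4) by fastforce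
    then have "frechet_derivative u (at y) = (\<lambda>v. Re (deriv g y * v))"
      by (metis frechet_derivative_at)
    then show "F y = deriv g y"
      by (simp add: F_def complex_eq_iff)
    with der show "(u has_derivative (\<lambda>v. Re (F y * v))) (at y)"
      by simp
  qed
  have "F holomorphic_on S"
  proof (rule holomorphic_onI)
    fix z assume "z \<in> S"
    then obtain U g where U: "open U" "z \<in> U" "g holomorphic_on U" "\<forall>y\<in>U. u y = Re (g y)"
      using loc by blast
    have "deriv g holomorphic_on U"
      using U holomorphic_deriv by blast
    then have "F holomorphic_on U"
      by (rule holomorphic_transform) (metis F(1) U)
    then show "F field_differentiable at z within S"
      using U by (meson field_differentiable_at_within holomorphic_on_imp_differentiable_at)
  qed
  then show thesis
  proof (rule primitive_imp_real_part[OF S])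
    show "(u has_derivative (\<lambda>v. Re (F z * v))) (at z)" if "z \<in> S" for z
      using loc[OF that] F(2) by blast
  qed (use that in blast)
qed

text \<open>The mean value theorem is applied first to the increment along \<open>w\<close> as a
  function of the step along \<open>v\<close>, then to the derivative along \<open>v\<close> as a
  function of the step along \<open>w\<close>. The second difference is symmetric in
  \<open>v\<close> and \<open>w\<close>, so exchanging them yields the other mixed
  derivative.\<close>

lemma second_difference_mean_value:
  fixes u :: "'a::real_normed_vector \<Rightarrow> real"
  assumes h: "0 < h"
    and sub: "\<And>s t. 0 \<le> s \<Longrightarrow> s \<le> h \<Longrightarrow> 0 \<le> t \<Longrightarrow> t \<le> h \<Longrightarrow> z + s *\<^sub>R v + t *\<^sub>R w \<in> S"
    and du: "\<And>x. x \<in> S \<Longrightarrow> u differentiable (at x)"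
    and ddu: "\<And>x. x \<in> S \<Longrightarrow> (\<lambda>x. frechet_derivative u (at x) v) differentiable (at x)"
  obtains s t where "0 < s" "s < h" "0 < t" "t < h"
    "u (z + h *\<^sub>R v + h *\<^sub>R w) - u (z + h *\<^sub>R v) - u (z + h *\<^sub>R w) + u z
      = h * h * frechet_derivative (\<lambda>x. frechet_derivative u (at x) v) (at (z + s *\<^sub>R v + t *\<^sub>R w)) w"
proof -
  have fd: "((\<lambda>t. f (c + t *\<^sub>R e)) has_real_derivative frechet_derivative f (at (c + r *\<^sub>R e)) e) (at r)"
    if "f differentiable (at (c + r *\<^sub>R e))" for f :: "'a \<Rightarrow> real" and c e r
  proof -
    have "(f has_derivative frechet_derivative f (at (c + r *\<^sub>R e))) (at (c + r *\<^sub>R e))"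
      using that by (simp add: frechet_derivative_works)
    moreover have "((\<lambda>t. c + t *\<^sub>R e) has_derivative (\<lambda>t. t *\<^sub>R e)) (at r)"
      by (auto intro!: derivative_eq_intros)
    ultimately have "((\<lambda>t. f (c + t *\<^sub>R e)) has_derivative (\<lambda>t. frechet_derivative f (at (c + r *\<^sub>R e)) (t *\<^sub>R e))) (at r)"
      using has_derivative_compose by fastforce
    moreover have "frechet_derivative f (at (c + r *\<^sub>R e)) (t *\<^sub>R e) = frechet_derivative f (at (c + r *\<^sub>R e)) e * t" for t
      using linear_frechet_derivative[OF that] by (simp add: linear_scale mult.commute)
    ultimately show ?thesis
      by (simp add: has_field_derivative_def)
  qed
  define p where "p x = frechet_derivative u (at x) v" for x
  define \<phi> where "\<phi> s = u (z + h *\<^sub>R w + s *\<^sub>R v) - u (z + s *\<^sub>R v)" for s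
  have "(\<phi> has_real_derivative p (z + h *\<^sub>R w + s *\<^sub>R v) - p (z + s *\<^sub>R v)) (at s)" if "0 \<le> s" "s \<le> h" for s
  proof -
    have "z + h *\<^sub>R w + s *\<^sub>R v \<in> S" "z + s *\<^sub>R v \<in> S"
      using sub[of s h] sub[of s 0] that h by (auto simp: algebra_simps)
    then show ?thesis
      unfolding \<phi>_def p_def by (intro DERIV_diff fd du)
  qed
  then obtain s where s: "0 < s" "s < h" "\<phi> h - \<phi> 0 = (h - 0) * (p (z + h *\<^sub>R w + s *\<^sub>R v) - p (z + s *\<^sub>R v))"
    using MVT2[OF h, of \<phi> "\<lambda>s. p (z + h *\<^sub>R w + s *\<^sub>R v) - p (z + s *\<^sub>R v)"] by blast
  have "((\<lambda>t. p (z + s *\<^sub>R v + t *\<^sub>R w)) has_real_derivative frechet_derivative p (at (z + s *\<^sub>R v + t *\<^sub>R w)) w) (at t)"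
    if "0 \<le> t" "t \<le> h" for t
    using sub[of s t] that s ddu by (intro fd) (auto simp: p_def)
  then obtain t where t: "0 < t" "t < h"
    "p (z + s *\<^sub>R v + h *\<^sub>R w) - p (z + s *\<^sub>R v + 0 *\<^sub>R w) = (h - 0) * frechet_derivative p (at (z + s *\<^sub>R v + t *\<^sub>R w)) w"
    using MVT2[OF h, of "\<lambda>t. p (z + s *\<^sub>R v + t *\<^sub>R w)" "\<lambda>t. frechet_derivative p (at (z + s *\<^sub>R v + t *\<^sub>R w)) w"] by blast
  show thesis
  proof
    have "\<phi> h - \<phi> 0 = h * (h * frechet_derivative p (at (z + s *\<^sub>R v + t *\<^sub>R w)) w)"
      using s(3) t(3) by (simp add: add_ac)
    then show "u (z + h *\<^sub>R v + h *\<^sub>R w) - u (z + h *\<^sub>R v) - u (z + h *\<^sub>R w) + u z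
      = h * h * frechet_derivative (\<lambda>x. frechet_derivative u (at x) v) (at (z + s *\<^sub>R v + t *\<^sub>R w)) w"
      by (simp add: \<phi>_def p_def[abs_def] algebra_simps)
  qed (use s t in auto)
qed

text \<open>The same second difference is \<open>h * h\<close> times either mixed derivative, each
  taken at some point near \<open>z\<close>. If the two differed at \<open>z\<close>, continuity
  with tolerance half their distance would contradict this.\<close>

lemma Ck_on_2_symmetric:
  fixes u :: "'a::real_normed_vector \<Rightarrow> real"
  assumes S: "open S" "z \<in> S" and C2: "Ck_on 2 S u"
  shows "frechet_derivative (\<lambda>x. frechet_derivative u (at x) v) (at z) w
       = frechet_derivative (\<lambda>x. frechet_derivative u (at x) w) (at z) v"
proof (rule ccontr)
  define D where "D v w x = frechet_derivative (\<lambda>x. frechet_derivative u (at x) v) (at x) w" for v w x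
  have C: "u differentiable (at x)" "(\<lambda>x. frechet_derivative u (at x) v) differentiable (at x)"
    "continuous_on S (D v w)" if "x \<in> S" for x v w
    using C2 that by (auto simp: numeral_2_eq_2 D_def)
  assume "\<not> ?thesis"
  then have ne: "D v w z \<noteq> D w v z"
    by (simp add: D_def)
  define e where "e = dist (D v w z) (D w v z) / 2"
  have e: "e > 0"
    using ne by (simp add: e_def)
  obtain d0 where d0: "d0 > 0" "ball z d0 \<subseteq> S"
    using S open_contains_ball by blast
  have cont: "\<exists>d>0. \<forall>x. dist x z < d \<longrightarrow> dist (D v w x) (D v w z) < e" for v w
    using C(3)[OF S(2)] S e by (metis continuous_at_eps_delta continuous_on_eq_continuous_at dist_norm dist_commute dist_real_def)
  obtain d1 where d1: "d1 > 0" "\<And>x. dist x z < d1 \<Longrightarrow> dist (D v w x) (D v w z) < e"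
    using cont by blast
  obtain d2 where d2: "d2 > 0" "\<And>x. dist x z < d2 \<Longrightarrow> dist (D w v x) (D w v z) < e"
    using cont by blast
  define d where "d = min d0 (min d1 d2)"
  \<comment> \<open>This size keeps the whole parallelogram within \<open>d\<close> of
    \<open>z\<close>; the summand 1 keeps the denominator positive.\<close>
  define h where "h = d / (2 * (norm v + norm w + 1))"
  have nn: "norm v + norm w + 1 > 0"
    by (simp add: add_nonneg_pos)
  have h: "h > 0"
    using d0 d1 d2 nn by (simp add: h_def d_def)
  have near: "dist (z + s *\<^sub>R v + t *\<^sub>R w) z < d" "dist (z + t *\<^sub>R w + s *\<^sub>R v) z < d"
    if "0 \<le> s" "s \<le> h" "0 \<le> t" "t \<le> h" for s t
  proof -
    have "norm (s *\<^sub>R v + t *\<^sub>R w) \<le> s * norm v + t * norm w"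
      using that norm_triangle_ineq[of "s *\<^sub>R v" "t *\<^sub>R w"] by simp
    also have "\<dots> \<le> h * norm v + h * norm w"
      using that by (intro add_mono mult_right_mono) auto
    also have "\<dots> < 2 * (h * (norm v + norm w + 1))"
      using h by (simp add: algebra_simps add_nonneg_pos add_pos_nonneg)
    also have "\<dots> = d"
      using nn by (simp add: h_def divide_simps)
    finally show "dist (z + s *\<^sub>R v + t *\<^sub>R w) z < d" "dist (z + t *\<^sub>R w + s *\<^sub>R v) z < d"
      by (simp_all add: dist_norm add_ac)
  qed
  have inS: "x \<in> S" if "dist x z < d" for x
    using that d0 by (auto simp: d_def dist_commute)
  obtain s t where 1: "0 < s" "s < h" "0 < t" "t < h"
    "u (z + h *\<^sub>R v + h *\<^sub>R w) - u (z + h *\<^sub>R v) - u (z + h *\<^sub>R w) + u z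
      = h * h * D v w (z + s *\<^sub>R v + t *\<^sub>R w)"
    unfolding D_def using second_difference_mean_value[OF h inS[OF near(1)] C(1,2)] .
  obtain s' t' where 2: "0 < s'" "s' < h" "0 < t'" "t' < h"
    "u (z + h *\<^sub>R w + h *\<^sub>R v) - u (z + h *\<^sub>R w) - u (z + h *\<^sub>R v) + u z
      = h * h * D w v (z + s' *\<^sub>R w + t' *\<^sub>R v)"
    unfolding D_def using second_difference_mean_value[of h z w v S u, OF h inS[OF near(2)] C(1,2)] by blast
  have "h * h * D v w (z + s *\<^sub>R v + t *\<^sub>R w) = h * h * D w v (z + s' *\<^sub>R w + t' *\<^sub>R v)"
  proof -
    have swap: "z + h *\<^sub>R w + h *\<^sub>R v = z + h *\<^sub>R v + h *\<^sub>R w"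
      by simp
    show ?thesis
      using 1(5) 2(5)[unfolded swap] by linarith
  qed
  then have "D v w (z + s *\<^sub>R v + t *\<^sub>R w) = D w v (z + s' *\<^sub>R w + t' *\<^sub>R v)"
    using h by simp
  moreover have "dist (D v w (z + s *\<^sub>R v + t *\<^sub>R w)) (D v w z) < e"
    using near(1)[of s t] 1 by (intro d1(2)) (auto simp: d_def)
  moreover have "dist (D w v (z + s' *\<^sub>R w + t' *\<^sub>R v)) (D w v z) < e"
    using near(2)[of t' s'] 2 by (intro d2(2)) (auto simp: d_def)
  ultimately have "dist (D v w z) (D w v z) < dist (D v w z) (D w v z)"
    unfolding e_def by (metis dist_triangle_half_r)
  then show False
    by simp
qed

text \<open>The Cauchy-Riemann equations for \<open>F = u_x - i u_y\<close> are the symmetry of the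
  mixed derivatives and the vanishing of the Laplacian. Then \<open>k\<close> is a suitable
  primitive of \<open>F\<close>.\<close>

lemma harmonic_imp_real_part:
  assumes S: "open S" "ball z0 e \<subseteq> S" and C2: "Ck_on 2 S u"
    and lap: "\<And>z. z \<in> S \<Longrightarrow> laplacian u z = 0"
  obtains k where "k holomorphic_on ball z0 e"
    "\<forall>z\<in>ball z0 e. (u has_derivative (\<lambda>v. Re (deriv k z * v))) (at z)"
    "\<forall>z\<in>ball z0 e. u z = Re (k z)"
proof -
  define p q where "p x = frechet_derivative u (at x) 1" and "q x = frechet_derivative u (at x) \<i>" for x
  define F where "F z = complex_of_real (p z) - \<i> * complex_of_real (q z)" for z
  have C: "u differentiable (at x)" "p differentiable (at x)" "q differentiable (at x)" if "x \<in> S" for x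
    using C2 that by (auto simp: numeral_2_eq_2 p_def[abs_def] q_def[abs_def])
  have lin: "f v = Re v * f 1 + Im v * f \<i>" if "linear f" for f :: "complex \<Rightarrow> real" and v
  proof -
    have "v = Re v *\<^sub>R 1 + Im v *\<^sub>R \<i>"
      by (simp add: complex_eq_iff)
    then have "f v = f (Re v *\<^sub>R 1 + Im v *\<^sub>R \<i>)"
      by simp
    also have "\<dots> = Re v * f 1 + Im v * f \<i>"
      using that by (simp add: linear_add linear_scale)
    finally show ?thesis .
  qed
  have du: "(u has_derivative (\<lambda>v. Re (F x * v))) (at x)" if "x \<in> S" for x
  proof -
    have "frechet_derivative u (at x) v = Re (F x * v)" for v
      using lin[OF linear_frechet_derivative[OF C(1)[OF that]], of v] by (simp add: F_def p_def q_def)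
    then show ?thesis
      using C(1)[OF that] frechet_derivative_works by (metis (no_types, lifting) ext)
  qed
  have holF: "F holomorphic_on ball z0 e"
  proof (rule holomorphic_onI)
    fix x assume "x \<in> ball z0 e"
    then have x: "x \<in> S"
      using S by blast
    define a b where "a = frechet_derivative p (at x) 1" and "b = frechet_derivative p (at x) \<i>"
    have "frechet_derivative q (at x) 1 = b"
      using Ck_on_2_symmetric[OF S(1) x C2, of \<i> 1] by (simp add: b_def p_def[abs_def] q_def[abs_def])
    moreover have "frechet_derivative q (at x) \<i> = - a"
      using lap[OF x] by (simp add: laplacian_def a_def p_def[abs_def] q_def[abs_def])
    ultimately have dq: "frechet_derivative q (at x) v = Re v * b - Im v * a" for v
      using lin[OF linear_frechet_derivative[OF C(3)[OF x]], of v] by simp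
    have dp: "frechet_derivative p (at x) v = Re v * a + Im v * b" for v
      using lin[OF linear_frechet_derivative[OF C(2)[OF x]], of v] by (simp add: a_def b_def)
    have "(p has_derivative (\<lambda>v. Re v * a + Im v * b)) (at x)" "(q has_derivative (\<lambda>v. Re v * b - Im v * a)) (at x)"
      using C(2,3)[OF x] dp dq frechet_derivative_works
      by (metis (no_types, lifting) ext)+
    then have "(F has_derivative (\<lambda>v. complex_of_real (Re v * a + Im v * b) - \<i> * complex_of_real (Re v * b - Im v * a))) (at x)"
      unfolding F_def[abs_def] by (intro has_derivative_diff has_derivative_mult_right has_derivative_of_real)
    moreover have "complex_of_real (Re v * a + Im v * b) - \<i> * complex_of_real (Re v * b - Im v * a) = Complex a (- b) * v" for v
      by (simp add: complex_eq_iff algebra_simps)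
    ultimately have "(F has_field_derivative Complex a (- b)) (at x)"
      by (simp add: has_field_derivative_def)
    then show "F field_differentiable at x within ball z0 e"
      using field_differentiable_at_within field_differentiable_def by blast
  qed
  show thesis
  proof (rule primitive_imp_real_part[OF convex_ball open_ball holF])
    show "(u has_derivative (\<lambda>v. Re (F x * v))) (at x)" if "x \<in> ball z0 e" for x
      using du that S by blast
  next
    fix k assume k: "k holomorphic_on ball z0 e" "\<And>x. x \<in> ball z0 e \<Longrightarrow> (k has_field_derivative F x) (at x)"
      "\<And>x. x \<in> ball z0 e \<Longrightarrow> u x = Re (k x)"
    show thesis
    proof (rule that[OF k(1)])
      show "\<forall>x\<in>ball z0 e. (u has_derivative (\<lambda>v. Re (deriv k x * v))) (at x)"
        using du S(2) DERIV_imp_deriv[OF k(2)] by auto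
    qed (use k(3) in blast)
  qed
qed

section \<open>Chains of discs\<close>

lemma cmod_Moebius_lt_1:
  assumes "a \<in> ball 0 1" "b \<in> ball 0 1"
  shows "cmod ((a - b) / (1 - cnj b * a)) < 1"
  using Moebius_function_norm_lt_1[of b a 0] assms by (simp add: Moebius_function_simple)

lemma poincare_dist_nonneg:
  assumes "a \<in> ball 0 1" "b \<in> ball 0 1"
  shows "0 \<le> poincare_dist a b"
  unfolding poincare_dist_def using cmod_Moebius_lt_1[OF assms] by (intro artanh_nonneg) auto

lemma holomorphic_disc_in:
  assumes "holomorphic_disc \<A> W f" "t \<in> ball 0 1"
  shows "f t \<in> W"
  using assms unfolding holomorphic_disc_def by blast

lemma holomorphic_disc_compose:
  assumes f: "holomorphic_disc \<A> W f"
    and M: "M holomorphic_on ball 0 1" "M ` ball 0 1 \<subseteq> ball 0 1"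
  shows "holomorphic_disc \<A> W (\<lambda>z. f (M z))"
  unfolding holomorphic_disc_def
proof (intro conjI)
  show "(\<lambda>z. f (M z)) ` ball 0 1 \<subseteq> W"
    using f M by (fastforce simp: holomorphic_disc_def)
  show "continuous_on (ball 0 1) (\<lambda>z. f (M z))"
    using f M by (auto simp: holomorphic_disc_def intro: continuous_on_compose2 holomorphic_on_imp_continuous_on)
  show "\<forall>(U, \<phi>)\<in>\<A>. (\<lambda>z. \<phi> (fst (f (M z)))) holomorphic_on {z \<in> ball 0 1. fst (f (M z)) \<in> U}"
  proof (clarify)
    fix U \<phi> assume "(U, \<phi>) \<in> \<A>"
    then have "(\<lambda>\<zeta>. \<phi> (fst (f \<zeta>))) holomorphic_on {\<zeta>\<in>ball 0 1. fst (f \<zeta>) \<in> U}"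
      using f by (auto simp: holomorphic_disc_def)
    moreover have "M holomorphic_on {z \<in> ball 0 1. fst (f (M z)) \<in> U}"
      using M by (auto intro: holomorphic_on_subset)
    ultimately show "(\<lambda>z. \<phi> (fst (f (M z)))) holomorphic_on {z \<in> ball 0 1. fst (f (M z)) \<in> U}"
      using M(2) holomorphic_on_compose_gen[of M _ "\<lambda>\<zeta>. \<phi> (fst (f \<zeta>))"] by (fastforce simp: o_def)
  qed
  show "(\<lambda>z. snd (f (M z))) holomorphic_on ball 0 1"
    using f M holomorphic_on_compose_gen[of M "ball 0 1" "\<lambda>\<zeta>. snd (f \<zeta>)" "ball 0 1"]
    by (auto simp: holomorphic_disc_def o_def)
qed

text \<open>Precomposition with the disc automorphism taking 0 to \<open>a\<close>. It lets every
  link of a chain start at the centre, where the Schwarz and Harnack estimates apply.\<close>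

lemma holomorphic_disc_recentre:
  assumes f: "holomorphic_disc \<A> W f" and ab: "a \<in> ball 0 1" "b \<in> ball 0 1"
  obtains g c where "holomorphic_disc \<A> W g" "g 0 = f a" "g c = f b" "cmod c < 1"
    "poincare_dist a b = artanh (cmod c)"
proof
  have a: "cmod (- a) < 1" "cmod a < 1"
    using ab by auto
  show "holomorphic_disc \<A> W (\<lambda>z. f (Moebius_function 0 (- a) z))"
    using Moebius_function_holomorphic[OF a(1)] Moebius_function_norm_lt_1[OF a(1)]
    by (intro holomorphic_disc_compose[OF f]) auto
  show "f (Moebius_function 0 (- a) 0) = f a"
    by (simp add: Moebius_function_simple)
  show "f (Moebius_function 0 (- a) (Moebius_function 0 a b)) = f b"
    using Moebius_function_compose[of "- a" a b] ab by simp
  show "cmod (Moebius_function 0 a b) < 1"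
    using ab by (intro Moebius_function_norm_lt_1) auto
  have "cmod (1 - cnj b * a) = cmod (cnj (1 - cnj b * a))"
    by (simp only: complex_mod_cnj)
  then have "cmod (1 - cnj b * a) = cmod (1 - cnj a * b)"
    by (simp add: mult.commute)
  then show "poincare_dist a b = artanh (cmod (Moebius_function 0 a b))"
    by (simp add: poincare_dist_def Moebius_function_simple norm_divide norm_minus_commute)
qed

lemma disc_chain_nonneg:
  "disc_chain \<A> W p q l \<Longrightarrow> 0 \<le> l"
  by (induction rule: disc_chain.induct) (auto simp del: mem_ball intro!: add_nonneg_nonneg poincare_dist_nonneg)

lemma disc_chain_disc:
  assumes "holomorphic_disc \<A> W f" "a \<in> ball 0 1" "b \<in> ball 0 1"
  shows "disc_chain \<A> W (f a) (f b) (poincare_dist a b)"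
proof -
  have "f a \<in> W"
    using assms by (auto simp: holomorphic_disc_def)
  then show ?thesis
    using disc_chain.step[OF disc_chain.refl assms] by simp
qed

lemma kobayashi_dist_le:
  assumes "holomorphic_disc \<A> W f" "a \<in> ball 0 1" "b \<in> ball 0 1"
  shows "kobayashi_dist \<A> W (f a) (f b) \<le> poincare_dist a b"
  unfolding kobayashi_dist_def
  using disc_chain_disc[OF assms] by (intro cInf_lower bdd_belowI[of _ 0]) (auto dest: disc_chain_nonneg)

text \<open>The chain of length \<open>l0\<close> makes the set of lengths nonempty, so that
  \<open>Inf\<close> is a genuine infimum.\<close>

lemma kobayashi_dist_ge:
  assumes "disc_chain \<A> W p q l0" "\<And>l. disc_chain \<A> W p q l \<Longrightarrow> M \<le> l"
  shows "M \<le> kobayashi_dist \<A> W p q"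
  unfolding kobayashi_dist_def using assms by (intro cInf_greatest) auto

text \<open>Increments along the recentred links add up. Functions \<open>\<Phi>\<close> of this
  kind bound the Kobayashi distance from below.\<close>

lemma disc_chain_Lipschitz:
  assumes chain: "disc_chain \<A> W p q l"
    and lip: "\<And>f c. holomorphic_disc \<A> W f \<Longrightarrow> cmod c < 1 \<Longrightarrow> \<bar>\<Phi> (f c) - \<Phi> (f 0)\<bar> \<le> C * artanh (cmod c)"
  shows "\<bar>\<Phi> q - \<Phi> p\<bar> \<le> C * l"
  using chain
proof induction
  case (step p f a l b)
  obtain g c where "holomorphic_disc \<A> W g" "g 0 = f a" "g c = f b" "cmod c < 1"
    "poincare_dist a b = artanh (cmod c)"
    using holomorphic_disc_recentre[OF step.hyps(2-4)] .
  then have "\<bar>\<Phi> (f b) - \<Phi> (f a)\<bar> \<le> C * poincare_dist a b"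
    using lip[of g c] by simp
  then show ?case
    using step.IH by (simp add: distrib_left)
qed simp

text \<open>In each alternative of the minimum one distance to \<open>p\<close> cancels. In this
  form the diagonals of a quadrilateral are compared with its sides.\<close>

lemma gromov_product_four_point:
  assumes "min (gromov_product d x z p) (gromov_product d y z p) - \<delta> \<le> gromov_product d x y p"
  shows "d x y + d z p \<le> max (d x z + d y p) (d y z + d x p) + 2 * \<delta>"
proof -
  have "gromov_product d x z p - \<delta> \<le> gromov_product d x y p \<or> gromov_product d y z p - \<delta> \<le> gromov_product d x y p"
    using assms by linarith
  then have "d x y + d z p \<le> d x z + d y p + 2 * \<delta> \<or> d x y + d z p \<le> d y z + d x p + 2 * \<delta>"
    unfolding gromov_product_def by (elim disj_forward) (simp_all add: field_simps)
  then show ?thesis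
    by linarith
qed

section \<open>Worms\<close>

context worm
begin

section \<open>Harmonicity of \<theta> and the maximum principle on the surface\<close>

text \<open>The derivative clause later turns a noncritical point of \<open>\<theta>\<close> into a
  nonzero derivative of \<open>k\<close>.\<close>

lemma local_real_part:
  assumes "z \<in> Y"
  obtains U \<phi> e k where "(U, \<phi>) \<in> \<A>" "z \<in> U" "e > 0" "ball (\<phi> z) e \<subseteq> \<phi> ` U"
    "k holomorphic_on ball (\<phi> z) e"
    "\<forall>\<zeta>\<in>ball (\<phi> z) e. ((\<theta> \<circ> inv_into U \<phi>) has_derivative (\<lambda>v. Re (deriv k \<zeta> * v))) (at \<zeta>)"
    "\<forall>\<zeta>\<in>ball (\<phi> z) e. \<theta> (inv_into U \<phi> \<zeta>) = Re (k \<zeta>)"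
proof -
  obtain U \<phi> where U: "(U, \<phi>) \<in> \<A>" "z \<in> U"
    using assms covers by blast
  have op: "open (\<phi> ` U)"
    using charts[OF U(1)] by (simp add: complex_chart_def)
  then obtain e where e: "e > 0" "ball (\<phi> z) e \<subseteq> \<phi> ` U"
    using U(2) open_contains_ball by blast
  have C2: "Ck_on 2 (\<phi> ` U) (\<theta> \<circ> inv_into U \<phi>)"
    and lap: "\<And>\<zeta>. \<zeta> \<in> \<phi> ` U \<Longrightarrow> laplacian (\<theta> \<circ> inv_into U \<phi>) \<zeta> = 0"
    using bspec[OF theta_harmonic[unfolded harmonic_fun_def] U(1)] by auto
  obtain k where "k holomorphic_on ball (\<phi> z) e"
    "\<forall>\<zeta>\<in>ball (\<phi> z) e. ((\<theta> \<circ> inv_into U \<phi>) has_derivative (\<lambda>v. Re (deriv k \<zeta> * v))) (at \<zeta>)"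
    "\<forall>\<zeta>\<in>ball (\<phi> z) e. (\<theta> \<circ> inv_into U \<phi>) \<zeta> = Re (k \<zeta>)"
    using harmonic_imp_real_part[OF op e(2) C2 lap] .
  then show thesis
    using that[OF U e] by simp
qed

text \<open>Here the local real part lives on an open subset of the surface. The last clause carries
  bounds on \<open>N\<close> over to the whole ball, where the maximum modulus principle is
  applied.\<close>

lemma local_real_part_nbhd:
  assumes "z \<in> Y"
  obtains U \<phi> e N k where "(U, \<phi>) \<in> \<A>" "e > 0" "open N" "z \<in> N" "N \<subseteq> U" "\<phi> ` N \<subseteq> ball (\<phi> z) e"
    "k holomorphic_on ball (\<phi> z) e" "\<forall>y\<in>N. \<theta> y = Re (k (\<phi> y))" "continuous_on N \<phi>"
    "ball (\<phi> z) e \<subseteq> \<phi> ` N"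
proof -
  obtain U \<phi> e k where U: "(U, \<phi>) \<in> \<A>" "z \<in> U" "e > 0" "ball (\<phi> z) e \<subseteq> \<phi> ` U"
    and k: "k holomorphic_on ball (\<phi> z) e"
    "\<forall>\<zeta>\<in>ball (\<phi> z) e. ((\<theta> \<circ> inv_into U \<phi>) has_derivative (\<lambda>v. Re (deriv k \<zeta> * v))) (at \<zeta>)"
    "\<forall>\<zeta>\<in>ball (\<phi> z) e. \<theta> (inv_into U \<phi> \<zeta>) = Re (k \<zeta>)"
    using local_real_part[OF assms] .
  have op: "open U" and cont: "continuous_on U \<phi>" and inv: "\<And>y. y \<in> U \<Longrightarrow> inv_into U \<phi> (\<phi> y) = y"
    using charts[OF U(1)] by (auto simp: complex_chart_def homeomorphism_def)
  show thesis
  proof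
    define N where "N = U \<inter> \<phi> -` ball (\<phi> z) e"
    show "(U, \<phi>) \<in> \<A>" "e > 0" "k holomorphic_on ball (\<phi> z) e"
      by fact+
    have "open (\<phi> -` ball (\<phi> z) e \<inter> U)"
      using cont by (simp only: continuous_on_open_vimage[OF op] open_ball)
    then show "open N"
      by (simp add: N_def Int_commute)
    show "z \<in> N" "N \<subseteq> U" "\<phi> ` N \<subseteq> ball (\<phi> z) e"
      using U by (auto simp: N_def)
    show "\<forall>y\<in>N. \<theta> y = Re (k (\<phi> y))"
    proof
      fix y assume "y \<in> N"
      then have y: "y \<in> U" "\<phi> y \<in> ball (\<phi> z) e"
        by (simp_all add: N_def)
      show "\<theta> y = Re (k (\<phi> y))"
        using bspec[OF k(3) y(2)] inv[OF y(1)] by simp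
    qed
    show "continuous_on N \<phi>"
      by (rule continuous_on_subset[OF cont]) (simp add: N_def)
    show "ball (\<phi> z) e \<subseteq> \<phi> ` N"
      using U(4) by (auto simp: N_def)
  qed
qed

lemma continuous_on_theta: "continuous_on Y \<theta>"
proof (rule continuous_at_imp_continuous_on, clarify)
  fix z assume z: "z \<in> Y"
  obtain U \<phi> e N k where U: "(U, \<phi>) \<in> \<A>" "e > 0" and N: "open N" "z \<in> N" "N \<subseteq> U"
      "\<phi> ` N \<subseteq> ball (\<phi> z) e" "k holomorphic_on ball (\<phi> z) e" "\<forall>y\<in>N. \<theta> y = Re (k (\<phi> y))"
      "continuous_on N \<phi>" "ball (\<phi> z) e \<subseteq> \<phi> ` N"
    using local_real_part_nbhd[OF z] .
  have "continuous_on N (\<lambda>y. Re (k (\<phi> y)))"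
    using N continuous_on_compose2[OF holomorphic_on_imp_continuous_on[OF N(5)] N(7,4)]
    by (intro continuous_intros) auto
  then have "continuous_on N \<theta>"
    using N(6) by (simp cong: continuous_on_cong)
  then show "isCont \<theta> z"
    using continuous_on_eq_continuous_at[OF N(1)] N(2) by blast
qed

text \<open>Since \<open>exp (s * k)\<close> has modulus \<open>exp (s * \<theta>)\<close>, the
  maximum modulus principle shows that the set where \<open>\<theta>\<close> takes its extremal
  value is open. It is also closed, and \<open>Y\<close> is connected. The sign of \<open>s\<close>
  covers maxima and minima together.\<close>

lemma extremum_imp_constant:
  assumes s: "s \<noteq> 0" and m: "m \<in> Y" and max: "\<And>y. y \<in> Y \<Longrightarrow> s * \<theta> y \<le> s * \<theta> m"
  shows "\<forall>y\<in>Y. \<theta> y = \<theta> m"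
proof -
  define M where "M = {y\<in>Y. \<theta> y = \<theta> m}"
  have "closedin (top_of_set Y) M"
    unfolding M_def by (rule continuous_closedin_preimage_constant[OF continuous_on_theta])
  moreover have "open M"
  proof (subst open_subopen, clarify)
    fix z assume "z \<in> M"
    then have z: "z \<in> Y" "\<theta> z = \<theta> m"
      by (auto simp: M_def)
    obtain U \<phi> e N k where U: "(U, \<phi>) \<in> \<A>" "e > 0" and N: "open N" "z \<in> N" "N \<subseteq> U"
      "\<phi> ` N \<subseteq> ball (\<phi> z) e" "k holomorphic_on ball (\<phi> z) e" "\<forall>y\<in>N. \<theta> y = Re (k (\<phi> y))"
      "continuous_on N \<phi>" "ball (\<phi> z) e \<subseteq> \<phi> ` N"
    using local_real_part_nbhd[OF z(1)] .
    have NY: "N \<subseteq> Y"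
      using N U covers by blast
    define h where "h \<zeta> = exp (of_real s * k \<zeta>)" for \<zeta>
    have norm_h: "cmod (h (\<phi> y)) = exp (s * \<theta> y)" if "y \<in> N" for y
      using bspec[OF N(6) that] by (simp add: h_def)
    have "h constant_on ball (\<phi> z) e"
    proof (rule maximum_modulus_principle[of h "ball (\<phi> z) e" "ball (\<phi> z) e" "\<phi> z"])
      show "h holomorphic_on ball (\<phi> z) e"
        unfolding h_def by (intro holomorphic_intros N(5))
      show "cmod (h \<zeta>) \<le> cmod (h (\<phi> z))" if "\<zeta> \<in> ball (\<phi> z) e" for \<zeta>
      proof -
        obtain y where "y \<in> N" "\<zeta> = \<phi> y"
          using N(8) \<open>\<zeta> \<in> ball (\<phi> z) e\<close> by (auto simp del: mem_ball)
        then show ?thesis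
          using norm_h N(2) max[of y] z NY by auto
      qed
    qed (use U in auto)
    then obtain c where c: "\<And>\<zeta>. \<zeta> \<in> ball (\<phi> z) e \<Longrightarrow> h \<zeta> = c"
      by (auto simp: constant_on_def)
    have "N \<subseteq> M"
    proof
      fix y assume y: "y \<in> N"
      have "h (\<phi> y) = h (\<phi> z)"
        using c y N(2,4) by (metis image_subset_iff)
      then have "exp (s * \<theta> y) = exp (s * \<theta> z)"
        using norm_h[OF y] norm_h[OF N(2)] by metis
      then show "y \<in> M"
        using s y z NY by (auto simp: M_def)
    qed
    then show "\<exists>T. open T \<and> z \<in> T \<and> T \<subseteq> M"
      using N by blast
  qed
  then have "openin (top_of_set Y) M"
    by (intro open_subset) (auto simp: M_def)
  ultimately have "M = {} \<or> M = Y"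
    using connected unfolding connected_clopen by blast
  then show ?thesis
    using m by (auto simp: M_def)
qed

section \<open>Points of the worm, the range of \<theta> and the growth of \<eta>\<close>

text \<open>In terms of \<open>v = w * cis (- \<theta> z)\<close> the defining inequality reads
  \<open>|v|^2 + \<eta> < 2 * Re v\<close>. Positivity of \<open>Re v\<close> serves the argument
  estimate, the bounds on \<open>|w|\<close> the logarithmic one, and the bound on
  \<open>\<eta>\<close> confines \<open>\<theta>\<close> where \<open>w\<close> is small.\<close>

lemma worm_domain_point:
  assumes "(z, w) \<in> worm_domain Y \<theta> \<eta>"
  shows "z \<in> Y" "\<theta> z \<in> J" "w \<noteq> 0" "cmod w < 2" "0 < Re (w * cis (- \<theta> z))" "\<eta> (\<theta> z) < 2 * cmod w"
proof -
  define v where "v = w * cis (- \<theta> z)"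
  have w: "z \<in> Y" "(cmod (w - cis (\<theta> z)))\<^sup>2 < 1 - \<eta> (\<theta> z)"
    using assms by (auto simp: worm_domain_def cis_conv_exp)
  have "w - cis (\<theta> z) = (v - 1) * cis (\<theta> z)"
    by (simp add: v_def algebra_simps cis_mult)
  then have "cmod (w - cis (\<theta> z)) = cmod (v - 1)"
    by (simp add: norm_mult)
  with w(2) have v: "(cmod (v - 1))\<^sup>2 < 1 - \<eta> (\<theta> z)"
    by simp
  have nv: "cmod v = cmod w"
    by (simp add: v_def norm_mult)
  have ex: "(cmod (v - 1))\<^sup>2 = (cmod v)\<^sup>2 - 2 * Re v + 1"
    by (simp add: cmod_power2) (simp add: power2_eq_square algebra_simps)
  have eta: "0 \<le> \<eta> (\<theta> z)"
    by (rule eta_nonneg)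
  show "z \<in> Y" by fact
  have "0 \<le> (cmod (v - 1))\<^sup>2"
    by simp
  then show "\<theta> z \<in> J"
    using v unfolding J_eq mem_Collect_eq by linarith
  show pos: "0 < Re (w * cis (- \<theta> z))"
    using v ex eta zero_le_power2[of "cmod v"] unfolding v_def[symmetric] by linarith
  then show "w \<noteq> 0"
    by auto
  show "\<eta> (\<theta> z) < 2 * cmod w"
    using v ex zero_le_power2[of "cmod v"] complex_Re_le_cmod[of v] nv by linarith
  have "(cmod (v - 1))\<^sup>2 < 1\<^sup>2"
    using v eta by simp
  then have "cmod (v - 1) < 1"
    by (rule power_less_imp_less_base) simp
  then show "cmod w < 2"
    using norm_triangle_ineq[of "v - 1" 1] nv by simp
qed

text \<open>If \<open>b\<close> were missed, connectedness would put all values on one side of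
  \<open>b\<close>. The extremum of \<open>\<theta>\<close> over the compact preimage of
  \<open>J\<close> would then be an extremum over \<open>Y\<close>, because values between it and
  \<open>b\<close> lie in \<open>J\<close>. So \<open>\<theta>\<close> would be constant and
  \<open>Y\<close> compact.\<close>

lemma theta_attains:
  assumes "b \<in> J"
  obtains q where "q \<in> Y" "\<theta> q = b"
proof -
  define K where "K = {z\<in>Y. \<theta> z \<in> J}"
  have K: "compact K" "continuous_on K \<theta>" "K \<noteq> {}"
    using theta_proper domain_nonempty worm_domain_point(1,2) continuous_on_subset[OF continuous_on_theta]
    by (fastforce simp: K_def)+
  have False if none: "\<And>q. q \<in> Y \<Longrightarrow> \<theta> q \<noteq> b"
  proof -
    have int: "is_interval (\<theta> ` Y)"
      using connected continuous_on_theta connected_continuous_image is_interval_connected_1 by blast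
    have const: False if "s \<noteq> 0" "m \<in> K" "\<And>y. y \<in> Y \<Longrightarrow> s * \<theta> y \<le> s * \<theta> m" for s m
    proof -
      have "K = Y"
        using extremum_imp_constant[OF that(1) _ that(3)] that(2) by (auto simp: K_def)
      then show False
        using K(1) noncompact by simp
    qed
    have "(\<forall>y\<in>Y. \<theta> y < b) \<or> (\<forall>y\<in>Y. b < \<theta> y)"
    proof (rule ccontr)
      assume "\<not> ?thesis"
      then obtain y1 y2 where y: "y1 \<in> Y" "y2 \<in> Y" "\<theta> y2 \<le> b" "b \<le> \<theta> y1"
        by force
      have "b \<in> \<theta> ` Y"
        by (rule mem_is_interval_1_I[OF int _ _ y(3,4)]) (use y in auto)
      then show False
        using none by blast
    qed
    then show False
    proof
      assume less: "\<forall>y\<in>Y. \<theta> y < b"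
      obtain m where m: "m \<in> K" "\<And>y. y \<in> K \<Longrightarrow> \<theta> y \<le> \<theta> m"
        using continuous_attains_sup[OF K(1,3,2)] by blast
      have "\<theta> y \<le> \<theta> m" if "y \<in> Y" for y
      proof (rule ccontr)
        assume "\<not> \<theta> y \<le> \<theta> m"
        then have "\<theta> y \<in> J"
          using mem_is_interval_1_I[OF J_interval(1), of "\<theta> m" b "\<theta> y"] assms m(1) less that
          by (auto simp: K_def)
        then show False
          using m(2)[of y] that \<open>\<not> \<theta> y \<le> \<theta> m\<close> by (auto simp: K_def)
      qed
      then show False
        using const[of 1 m] m(1) by simp
    next
      assume less: "\<forall>y\<in>Y. b < \<theta> y"
      obtain m where m: "m \<in> K" "\<And>y. y \<in> K \<Longrightarrow> \<theta> m \<le> \<theta> y"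
        using continuous_attains_inf[OF K(1,3,2)] by blast
      have "\<theta> m \<le> \<theta> y" if "y \<in> Y" for y
      proof (rule ccontr)
        assume "\<not> \<theta> m \<le> \<theta> y"
        then have "\<theta> y \<in> J"
          using mem_is_interval_1_I[OF J_interval(1), of b "\<theta> m" "\<theta> y"] assms m(1) less that
          by (auto simp: K_def)
        then show False
          using m(2)[of y] that \<open>\<not> \<theta> m \<le> \<theta> y\<close> by (auto simp: K_def)
      qed
      then show False
        using const[of "-1" m] m(1) by simp
    qed
  qed
  then show thesis
    using that by blast
qed

lemma I_endpoints:
  obtains a b where "a < b" "I = {a..b}"
proof -
  obtain a b where ab: "I = cbox a b"
    using I_interval is_interval_compact by blast
  then have "a < b"
    using I_interval(3) by (auto simp: interior_cbox)
  then show thesis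
    using that ab by simp
qed

text \<open>As \<open>\<eta>\<close> vanishes at \<open>b\<close> and is nonnegative, the mean value
  theorem gives a nonnegative slope somewhere in every interval starting at \<open>b\<close>, and
  strict convexity makes the slope positive beyond. So \<open>\<eta>\<close> increases there, and
  \<open>\<eta> B\<close> serves as \<open>\<kappa>\<close>.\<close>

lemma eta_lower_bound:
  assumes I: "I = {a..b}" "a < b" and B: "b < B"
  obtains \<kappa> where "\<kappa> > 0" "\<And>x. B \<le> x \<Longrightarrow> \<kappa> \<le> \<eta> x"
proof
  have "Ck_on 2 UNIV \<eta>"
    using eta_smooth by (simp add: smooth_on_def)
  then have diff: "\<eta> differentiable (at x)" "(\<lambda>x. frechet_derivative \<eta> (at x) 1) differentiable (at x)" for x
    by (auto simp: numeral_2_eq_2)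
  have D1: "(\<eta> has_real_derivative deriv \<eta> x) (at x)" for x
    using diff(1)[of x] by (simp add: DERIV_deriv_iff_real_differentiable)
  have "deriv \<eta> = (\<lambda>x. frechet_derivative \<eta> (at x) 1)"
  proof
    fix x
    have "frechet_derivative \<eta> (at x) = (*) (deriv \<eta> x)"
      using D1[of x] unfolding has_field_derivative_def by (metis frechet_derivative_at)
    then show "deriv \<eta> x = frechet_derivative \<eta> (at x) 1"
      by simp
  qed
  then have D2: "(deriv \<eta> has_real_derivative deriv (deriv \<eta>) x) (at x)" for x
    using diff(2)[of x] by (simp add: DERIV_deriv_iff_real_differentiable)
  have b: "\<eta> b = 0"
    using I by (intro eta_zero) auto
  have deriv_pos: "deriv \<eta> x > 0" if "b < x" for x
  proof -
    obtain y where y: "b < y" "y < x" "\<eta> x - \<eta> b = (x - b) * deriv \<eta> y"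
      using MVT2[of b x \<eta> "deriv \<eta>"] \<open>b < x\<close> D1 by blast
    have "deriv \<eta> y \<ge> 0"
      using y(3) b eta_nonneg[of x] that by (simp add: zero_le_mult_iff)
    moreover have "deriv \<eta> y < deriv \<eta> x"
    proof (rule DERIV_pos_imp_increasing[OF y(2)])
      show "\<exists>d. (deriv \<eta> has_real_derivative d) (at t) \<and> 0 < d" if "y \<le> t" "t \<le> x" for t
        using D2[of t] eta_convex[of t] that y I by auto
    qed
    ultimately show ?thesis
      by simp
  qed
  have mono: "\<eta> x < \<eta> y" if "b < x" "x < y" for x y
  proof (rule DERIV_pos_imp_increasing[OF that(2)])
    show "\<exists>d. (\<eta> has_real_derivative d) (at t) \<and> 0 < d" if "x \<le> t" "t \<le> y" for t
      using D1[of t] deriv_pos[of t] that \<open>b < x\<close> by auto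
  qed
  \<comment> \<open>The midpoint lies strictly to the right of \<open>b\<close>, where
    \<open>mono\<close> applies.\<close>
  show "\<eta> B > 0"
    using mono[of "(b + B) / 2" B] B eta_nonneg[of "(b + B) / 2"] by simp
  show "\<eta> B \<le> \<eta> x" if "B \<le> x" for x
    using mono[of B x] that B by (cases "B = x") auto
qed

section \<open>Argument, modulus and height along discs and chains\<close>

text \<open>Locally the composition of \<open>f\<close>, a chart and the local \<open>k\<close> will
  do; convexity of the disc makes this global.\<close>

lemma disc_theta_real_part:
  assumes f: "holomorphic_disc \<A> (worm_domain Y \<theta> \<eta>) f"
  obtains k where "k holomorphic_on ball 0 1" "\<forall>t\<in>ball 0 1. \<theta> (fst (f t)) = Re (k t)"
proof -
  have fW: "f t \<in> worm_domain Y \<theta> \<eta>" if "t \<in> ball 0 1" for t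
    using f that by (auto simp: holomorphic_disc_def)
  have cont: "continuous_on (ball 0 1) (\<lambda>t. fst (f t))"
    using f by (auto simp: holomorphic_disc_def intro: continuous_intros)
  have "\<exists>V g. open V \<and> t \<in> V \<and> g holomorphic_on V \<and> (\<forall>y\<in>V. \<theta> (fst (f y)) = Re (g y))" if t: "t \<in> ball 0 1" for t
  proof -
    have z: "fst (f t) \<in> Y"
      using worm_domain_point(1)[of "fst (f t)" "snd (f t)"] fW[OF t] by simp
    obtain U \<phi> e N k where U: "(U, \<phi>) \<in> \<A>" "e > 0" and N: "open N" "fst (f t) \<in> N" "N \<subseteq> U"
      "\<phi> ` N \<subseteq> ball (\<phi> (fst (f t))) e" "k holomorphic_on ball (\<phi> (fst (f t))) e" "\<forall>y\<in>N. \<theta> y = Re (k (\<phi> y))"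
      "continuous_on N \<phi>" "ball (\<phi> (fst (f t))) e \<subseteq> \<phi> ` N"
    using local_real_part_nbhd[OF z] .
    define V where "V = ball 0 1 \<inter> (\<lambda>t. fst (f t)) -` N"
    have "open V"
      unfolding V_def using cont N(1) by (metis Int_commute continuous_on_open_vimage open_ball)
    moreover have "t \<in> V"
      using t N by (simp add: V_def)
    moreover have "(\<lambda>y. k (\<phi> (fst (f y)))) holomorphic_on V"
    proof -
      have "(\<lambda>\<zeta>. \<phi> (fst (f \<zeta>))) holomorphic_on {\<zeta>\<in>ball 0 1. fst (f \<zeta>) \<in> U}"
        using f U(1) by (auto simp: holomorphic_disc_def)
      then have "(\<lambda>\<zeta>. \<phi> (fst (f \<zeta>))) holomorphic_on V"
        by (rule holomorphic_on_subset) (use N in \<open>auto simp: V_def\<close>)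
      moreover have "(\<lambda>\<zeta>. \<phi> (fst (f \<zeta>))) ` V \<subseteq> ball (\<phi> (fst (f t))) e"
        using N(4) by (auto simp: V_def)
      ultimately show ?thesis
        using holomorphic_on_compose_gen[of "\<lambda>\<zeta>. \<phi> (fst (f \<zeta>))" V k] N(5) by (auto simp: o_def)
    qed
    moreover have "\<forall>y\<in>V. \<theta> (fst (f y)) = Re (k (\<phi> (fst (f y))))"
      using N(6) by (auto simp: V_def)
    ultimately show ?thesis
      by blast
  qed
  then show thesis
    using locally_real_part_imp_real_part[OF convex_ball open_ball, of 0 1 "\<lambda>t. \<theta> (fst (f t))"] that by blast
qed

text \<open>With \<open>\<theta> = Re k\<close> along a disc,
  \<open>\<Omega> = w * exp (- \<i> * k)\<close> is holomorphic and a positive multiple of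
  \<open>w * cis (- \<theta>)\<close>. Hence it maps to the right half-plane and has the same slope
  \<open>Im / Re\<close>.\<close>

lemma disc_chain_argument:
  assumes "disc_chain \<A> (worm_domain Y \<theta> \<eta>) p q l"
  defines "\<alpha> \<equiv> \<lambda>p. arsinh (Im (snd p * cis (- \<theta> (fst p))) / Re (snd p * cis (- \<theta> (fst p))))"
  shows "\<bar>\<alpha> q - \<alpha> p\<bar> \<le> 2 * l"
proof (rule disc_chain_Lipschitz[OF assms(1)])
  fix f c assume f: "holomorphic_disc \<A> (worm_domain Y \<theta> \<eta>) f" and c: "cmod c < 1"
  obtain k where k: "k holomorphic_on ball 0 1" "\<forall>t\<in>ball 0 1. \<theta> (fst (f t)) = Re (k t)"
    using disc_theta_real_part[OF f] .
  define \<Omega> where "\<Omega> t = snd (f t) * exp (- \<i> * k t)" for t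
  have \<Omega>: "\<Omega> t = exp (Im (k t)) * (snd (f t) * cis (- \<theta> (fst (f t))))" if "t \<in> ball 0 1" for t
    using bspec[OF k(2) that] by (simp add: \<Omega>_def exp_eq_polar)
  have "\<bar>arsinh (Im (\<Omega> c) / Re (\<Omega> c)) - arsinh (Im (\<Omega> 0) / Re (\<Omega> 0))\<bar> \<le> 2 * artanh (cmod c)"
  proof (rule argument_Schwarz)
    show "\<Omega> holomorphic_on ball 0 1"
      unfolding \<Omega>_def using f by (intro holomorphic_intros k(1)) (auto simp: holomorphic_disc_def)
    show "0 < Re (\<Omega> t)" if "t \<in> ball 0 1" for t
    proof -
      have "(fst (f t), snd (f t)) \<in> worm_domain Y \<theta> \<eta>"
        using f that by (auto simp: holomorphic_disc_def)
      from worm_domain_point(5)[OF this] show ?thesis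
        unfolding \<Omega>[OF that] by simp
    qed
  qed fact
  moreover have "arsinh (Im (\<Omega> t) / Re (\<Omega> t)) = \<alpha> (f t)" if "t \<in> ball 0 1" for t
    unfolding \<Omega>[OF that] \<alpha>_def by simp
  ultimately show "\<bar>\<alpha> (f c) - \<alpha> (f 0)\<bar> \<le> 2 * artanh (cmod c)"
    using c by simp
qed

text \<open>The nonvanishing \<open>w\<close> has a logarithm \<open>m\<close> along the disc, and
  Harnack's inequality applies to \<open>ln 2 - m\<close>, whose real part is
  \<open>ln (2 / |w|) > 0\<close>.\<close>

lemma disc_radius:
  assumes f: "holomorphic_disc \<A> (worm_domain Y \<theta> \<eta>) f" and c: "cmod c < 1"
  shows "\<bar>ln (ln (2 / cmod (snd (f c)))) - ln (ln (2 / cmod (snd (f 0))))\<bar> \<le> 2 * artanh (cmod c)"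
proof -
  have W: "snd (f t) \<noteq> 0" "cmod (snd (f t)) < 2" if "t \<in> ball 0 1" for t
    using worm_domain_point(3,4)[of "fst (f t)" "snd (f t)"] holomorphic_disc_in[OF f that] by auto
  have hol: "(\<lambda>t. snd (f t)) holomorphic_on ball 0 1"
    using f by (simp add: holomorphic_disc_def)
  obtain m where m: "m holomorphic_on ball 0 1" "\<And>t. t \<in> ball 0 1 \<Longrightarrow> exp (m t) = snd (f t)"
    using holomorphic_logarithm_exists[OF convex_ball open_ball hol W(1), of 0] by auto
  have eq: "Re (of_real (ln 2) - m t) = ln (2 / cmod (snd (f t)))" if "t \<in> ball 0 1" for t
  proof -
    have "cmod (snd (f t)) = exp (Re (m t))"
      using m(2)[OF that] by (metis norm_exp_eq_Re)
    then show ?thesis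
      by (simp add: ln_div)
  qed
  have "\<bar>ln (Re (of_real (ln 2) - m c)) - ln (Re (of_real (ln 2) - m 0))\<bar> \<le> 2 * artanh (cmod c)"
  proof (rule Harnack_disc)
    show "(\<lambda>t. of_real (ln 2) - m t) holomorphic_on ball 0 1"
      by (intro holomorphic_intros m)
    show "0 < Re (of_real (ln 2) - m t)" if "t \<in> ball 0 1" for t
      unfolding eq[OF that] using W[OF that] by simp
  qed fact
  then show ?thesis
    using eq[of c] eq[of 0] c by simp
qed

text \<open>The factor \<open>4 * exp (2 * artanh (cmod c))\<close> dominates
  \<open>(3 + |c|) / (1 - |c|)\<close>, the Harnack constant for radius
  \<open>(1 + |c|) / 2\<close>. So \<open>|w| \<le> \<kappa>\<close>, hence
  \<open>\<theta> < B\<close>, on the disc of that radius. Harnack's inequality there and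
  \<open>artanh_double_le\<close> contribute a factor 2 each.\<close>

lemma disc_height:
  assumes f: "holomorphic_disc \<A> (worm_domain Y \<theta> \<eta>) f" and c: "cmod c < 1"
    and \<kappa>: "0 < \<kappa>" "\<kappa> \<le> 1" "\<And>z w. (z, w) \<in> worm_domain Y \<theta> \<eta> \<Longrightarrow> cmod w \<le> \<kappa> \<Longrightarrow> \<theta> z < B"
    and small: "4 * exp (2 * artanh (cmod c)) * ln (2 / \<kappa>) \<le> ln (2 / cmod (snd (f 0)))"
  shows "\<bar>ln (B - \<theta> (fst (f c))) - ln (B - \<theta> (fst (f 0)))\<bar> \<le> 4 * artanh (cmod c)"
proof -
  define r where "r = (1 + cmod c) / 2"
    \<comment> \<open>On the disc of radius \<open>r\<close> the function \<open>B - \<theta>\<close> is positive, and restricting to it at most doubles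
      the distance from \<open>0\<close> to \<open>c\<close>.\<close>
  have r: "0 < r" "r < 1" "cmod c < r"
    using c norm_ge_zero[of c] by (auto simp: r_def simp del: norm_ge_zero)
  have fW: "(fst (f t), snd (f t)) \<in> worm_domain Y \<theta> \<eta>" if "cmod t < 1" for t
    using f that by (auto simp: holomorphic_disc_def)
  have pos: "0 < ln (2 / cmod (snd (f t)))" if "cmod t < 1" for t
    using worm_domain_point(3,4)[OF fW[OF that]] by simp
  have pos\<kappa>: "0 < ln (2 / \<kappa>)"
    using \<kappa> by simp
  have lessB: "\<theta> (fst (f t)) < B" if t: "cmod t < r" for t
  proof (rule \<kappa>(3)[OF fW])
    show t1: "cmod t < 1"
      using t r by simp
    have "exp (2 * artanh (cmod t)) \<le> exp (2 * artanh r)"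
      using artanh_le_artanh[of "cmod t" r] t r by simp
    also have "\<dots> = (3 + cmod c) / (1 - cmod c)"
      using r c by (simp add: exp_two_artanh) (simp add: r_def divide_simps algebra_simps)
    also have "\<dots> \<le> 4 * ((1 + cmod c) / (1 - cmod c))"
      using c by (simp add: divide_right_mono)
    also have "\<dots> = 4 * exp (2 * artanh (cmod c))"
      using c by (simp add: exp_two_artanh)
    finally have "exp (2 * artanh (cmod t)) * ln (2 / \<kappa>) \<le> 4 * exp (2 * artanh (cmod c)) * ln (2 / \<kappa>)"
      using pos\<kappa> by (intro mult_right_mono) auto
    also have "\<dots> \<le> ln (2 / cmod (snd (f 0)))"
      by (rule small)
    also have "\<dots> \<le> exp (2 * artanh (cmod t)) * ln (2 / cmod (snd (f t)))"
    proof -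
      have "ln (ln (2 / cmod (snd (f 0)))) \<le> 2 * artanh (cmod t) + ln (ln (2 / cmod (snd (f t))))"
        using disc_radius[OF f t1] by linarith
      then have "exp (ln (ln (2 / cmod (snd (f 0))))) \<le> exp (2 * artanh (cmod t) + ln (ln (2 / cmod (snd (f t)))))"
        by simp
      then show ?thesis
        using pos[of 0] pos[OF t1] by (simp add: exp_add)
    qed
    finally have "ln (2 / \<kappa>) \<le> ln (2 / cmod (snd (f t)))"
      by simp
    then show "cmod (snd (f t)) \<le> \<kappa>"
      using \<kappa> worm_domain_point(3)[OF fW[OF t1]] by (simp add: field_simps)
  qed
  obtain k where k: "k holomorphic_on ball 0 1" "\<forall>t\<in>ball 0 1. \<theta> (fst (f t)) = Re (k t)"
    using disc_theta_real_part[OF f] .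
  define \<Omega> where "\<Omega> s = of_real B - k (of_real r * s)" for s
  have rs: "cmod (of_real r * s) < r" if "cmod s < 1" for s
    using that r by (simp add: norm_mult)
  have \<Omega>: "Re (\<Omega> s) = B - \<theta> (fst (f (of_real r * s)))" if "cmod s < 1" for s
    using bspec[OF k(2), of "of_real r * s"] rs[OF that] r by (simp add: \<Omega>_def)
  have cr: "cmod (c / of_real r) = cmod c / r" "cmod c / r < 1"
    using r by (auto simp: norm_divide)
  have "\<bar>ln (Re (\<Omega> (c / of_real r))) - ln (Re (\<Omega> 0))\<bar> \<le> 2 * artanh (cmod (c / of_real r))"
  proof (rule Harnack_disc)
    have "(\<lambda>s. complex_of_real r * s) ` ball 0 1 \<subseteq> ball 0 1"
      using less_trans[OF rs r(2)] by auto
    then have "(\<lambda>s. k (of_real r * s)) holomorphic_on ball 0 1"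
      using holomorphic_on_compose_gen[of "\<lambda>s. of_real r * s" "ball 0 1" k "ball 0 1"] k(1)
      by (auto simp: o_def intro!: holomorphic_intros)
    then show "\<Omega> holomorphic_on ball 0 1"
      unfolding \<Omega>_def by (intro holomorphic_intros)
    show "0 < Re (\<Omega> s)" if "s \<in> ball 0 1" for s
      using \<Omega>[of s] lessB[OF rs[of s]] that by simp
  qed (use cr in auto)
  also have "\<dots> \<le> 4 * artanh (cmod c)"
    using artanh_double_le[of "cmod c"] c unfolding cr(1) unfolding r_def by simp
  finally show ?thesis
    using \<Omega>[of "c / of_real r"] \<Omega>[of 0] cr r by simp
qed

text \<open>The estimate is available only on discs starting at tiny \<open>|w|\<close>. The factor
  \<open>exp (4 * L)\<close> is a reserve that covers both the decay of \<open>ln (2 / |w|)\<close>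
  along the chain so far and the demand of the next link.\<close>

lemma disc_chain_height:
  assumes "disc_chain \<A> (worm_domain Y \<theta> \<eta>) p q l" and "l \<le> L"
    and \<kappa>: "0 < \<kappa>" "\<kappa> \<le> 1" "\<And>z w. (z, w) \<in> worm_domain Y \<theta> \<eta> \<Longrightarrow> cmod w \<le> \<kappa> \<Longrightarrow> \<theta> z < B"
    and small: "4 * exp (4 * L) * ln (2 / \<kappa>) \<le> ln (2 / cmod (snd p))"
  shows "\<bar>ln (B - \<theta> (fst q)) - ln (B - \<theta> (fst p))\<bar> \<le> 4 * l"
  using assms(1,2) small
proof induction
  case (step p f a l b)
  obtain g c where g: "holomorphic_disc \<A> (worm_domain Y \<theta> \<eta>) g" "g 0 = f a" "g c = f b" "cmod c < 1"
    "poincare_dist a b = artanh (cmod c)"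
    using holomorphic_disc_recentre[OF step.hyps(2-4)] .
  have l: "0 \<le> l"
    using disc_chain_nonneg[OF step.hyps(1)] .
  have c0: "0 \<le> artanh (cmod c)"
    using g(4) by (intro artanh_nonneg) auto
  have pos\<kappa>: "0 < ln (2 / \<kappa>)"
    using \<kappa> by simp
  have "(fst (f a), snd (f a)) \<in> worm_domain Y \<theta> \<eta>"
    using holomorphic_disc_in[OF step.hyps(2,3)] by simp
  from worm_domain_point(3,4)[OF this] have pos: "0 < ln (2 / cmod (snd (f a)))"
    by simp
  have posp: "0 < ln (2 / cmod (snd p))"
    using step.prems(2) pos\<kappa> mult_pos_pos[of "4 * exp (4 * L)" "ln (2 / \<kappa>)"]
    by (metis exp_gt_zero less_le_trans mult_pos_pos zero_less_numeral)
  have "\<bar>ln (ln (2 / cmod (snd (f a)))) - ln (ln (2 / cmod (snd p)))\<bar> \<le> 2 * l"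
    using disc_chain_Lipschitz[OF step.hyps(1), of "\<lambda>p. ln (ln (2 / cmod (snd p)))"] disc_radius by blast
  then have "ln (ln (2 / cmod (snd p))) \<le> 2 * l + ln (ln (2 / cmod (snd (f a))))"
    by linarith
  then have "exp (ln (ln (2 / cmod (snd p)))) \<le> exp (2 * l + ln (ln (2 / cmod (snd (f a)))))"
    by simp
  then have rad: "ln (2 / cmod (snd p)) \<le> exp (2 * l) * ln (2 / cmod (snd (f a)))"
    using pos posp by (simp add: exp_add)
  have "exp (2 * l) * (4 * exp (2 * artanh (cmod c)) * ln (2 / \<kappa>)) = 4 * exp (2 * l + 2 * artanh (cmod c)) * ln (2 / \<kappa>)"
    by (simp add: exp_add)
  also have "\<dots> \<le> 4 * exp (4 * L) * ln (2 / \<kappa>)"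
    using pos\<kappa> step.prems(1) g(5) l c0 by (intro mult_right_mono mult_left_mono) auto
  also have "\<dots> \<le> exp (2 * l) * ln (2 / cmod (snd (f a)))"
    using step.prems(2) rad by linarith
  finally have "4 * exp (2 * artanh (cmod c)) * ln (2 / \<kappa>) \<le> ln (2 / cmod (snd (f a)))"
    by simp
  then have "\<bar>ln (B - \<theta> (fst (f b))) - ln (B - \<theta> (fst (f a)))\<bar> \<le> 4 * artanh (cmod c)"
    using disc_height[OF g(1,4) \<kappa>] g(2,3) by simp
  then show ?case
    using step.IH step.prems g(5) c0 by simp
qed simp

section \<open>A disc times a half-plane inside the worm\<close>

text \<open>At a noncritical point \<open>k\<close> is locally invertible, so up to an imaginary
  constant it is itself a coordinate with real part \<open>\<theta>\<close>. The map
  \<open>\<sigma>\<close> is the inverse of this coordinate.\<close>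

lemma conformal_parametrization:
  assumes q: "q \<in> Y" and nc: "\<not> critical_point \<A> \<theta> q"
  obtains \<rho> \<sigma> where "\<rho> > 0" "continuous_on (ball (of_real (\<theta> q)) \<rho>) \<sigma>"
    "\<And>\<zeta>. \<zeta> \<in> ball (of_real (\<theta> q)) \<rho> \<Longrightarrow> \<sigma> \<zeta> \<in> Y \<and> \<theta> (\<sigma> \<zeta>) = Re \<zeta>"
    "\<And>V \<psi>. (V, \<psi>) \<in> \<A> \<Longrightarrow> (\<lambda>\<zeta>. \<psi> (\<sigma> \<zeta>)) holomorphic_on {\<zeta> \<in> ball (of_real (\<theta> q)) \<rho>. \<sigma> \<zeta> \<in> V}"
proof -
  obtain U \<phi> e k where U: "(U, \<phi>) \<in> \<A>" "q \<in> U" "e > 0" "ball (\<phi> q) e \<subseteq> \<phi> ` U"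
    and k: "k holomorphic_on ball (\<phi> q) e"
    "\<forall>\<zeta>\<in>ball (\<phi> q) e. ((\<theta> \<circ> inv_into U \<phi>) has_derivative (\<lambda>v. Re (deriv k \<zeta> * v))) (at \<zeta>)"
    "\<forall>\<zeta>\<in>ball (\<phi> q) e. \<theta> (inv_into U \<phi> \<zeta>) = Re (k \<zeta>)"
    using local_real_part[OF q] .
  have cont: "continuous_on (\<phi> ` U) (inv_into U \<phi>)" and inv: "\<And>y. y \<in> U \<Longrightarrow> inv_into U \<phi> (\<phi> y) = y"
    using charts[OF U(1)] by (auto simp: complex_chart_def homeomorphism_def)
  have "deriv k (\<phi> q) \<noteq> 0"
  proof
    assume "deriv k (\<phi> q) = 0"
    then have "((\<theta> \<circ> inv_into U \<phi>) has_derivative (\<lambda>v. 0)) (at (\<phi> q))"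
      using bspec[OF k(2), of "\<phi> q"] U(3) by simp
    then have "frechet_derivative (\<theta> \<circ> inv_into U \<phi>) (at (\<phi> q)) = (\<lambda>v. 0)"
      by (metis frechet_derivative_at)
    then show False
      using nc U by (auto simp: critical_point_def)
  qed
  then obtain r where r: "r > 0" "ball (\<phi> q) r \<subseteq> ball (\<phi> q) e" "open (k ` ball (\<phi> q) r)" "inj_on k (ball (\<phi> q) r)"
    using has_complex_derivative_locally_invertible[OF k(1), of "\<phi> q"] U(3) by auto
  have holk: "k holomorphic_on ball (\<phi> q) r"
    using k(1) r(2) holomorphic_on_subset by blast
  obtain g where g: "g holomorphic_on k ` ball (\<phi> q) r" "\<And>z. z \<in> ball (\<phi> q) r \<Longrightarrow> g (k z) = z"
    using holomorphic_has_inverse[OF holk open_ball r(4)] by metis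
  \<comment> \<open>The shift gives \<open>q\<close> the real coordinate \<open>\<theta> q\<close>
    and leaves real parts unchanged.\<close>
  define d where "d = \<i> * of_real (Im (k (\<phi> q)))"
  have "k (\<phi> q) \<in> k ` ball (\<phi> q) r"
    using r by simp
  then obtain \<rho> where \<rho>: "\<rho> > 0" "ball (k (\<phi> q)) \<rho> \<subseteq> k ` ball (\<phi> q) r"
    using r(3) open_contains_ball by blast
  have kq: "k (\<phi> q) = of_real (\<theta> q) + d"
    using bspec[OF k(3), of "\<phi> q"] U inv[of q] by (simp add: d_def complex_eq_iff)
  have shift: "\<exists>x\<in>ball (\<phi> q) r. \<zeta> + d = k x \<and> g (\<zeta> + d) = x" if "\<zeta> \<in> ball (of_real (\<theta> q)) \<rho>" for \<zeta>
  proof -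
    have "\<zeta> + d \<in> ball (k (\<phi> q)) \<rho>"
      using that by (simp add: kq dist_norm)
    then show ?thesis
      using \<rho>(2) g(2) by fastforce
  qed
  have gin: "g (\<zeta> + d) \<in> ball (\<phi> q) e" "k (g (\<zeta> + d)) = \<zeta> + d" if "\<zeta> \<in> ball (of_real (\<theta> q)) \<rho>" for \<zeta>
    using shift[OF that] r(2) by auto
  define \<sigma> where "\<sigma> \<zeta> = inv_into U \<phi> (g (\<zeta> + d))" for \<zeta>
  have hol: "(\<lambda>\<zeta>. g (\<zeta> + d)) holomorphic_on ball (of_real (\<theta> q)) \<rho>"
    using holomorphic_on_compose_gen[of "\<lambda>\<zeta>. \<zeta> + d" "ball (of_real (\<theta> q)) \<rho>" g] g(1) shift
    by (force simp: o_def intro: holomorphic_intros)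
  have \<sigma>U: "\<sigma> \<zeta> \<in> U" "\<phi> (\<sigma> \<zeta>) = g (\<zeta> + d)" if "\<zeta> \<in> ball (of_real (\<theta> q)) \<rho>" for \<zeta>
    using gin(1)[OF that] U(4) by (auto simp: \<sigma>_def inv_into_into f_inv_into_f)
  show thesis
  proof
    show "\<rho> > 0" by fact
    show "continuous_on (ball (of_real (\<theta> q)) \<rho>) \<sigma>"
      unfolding \<sigma>_def using gin(1) U(4)
      by (intro continuous_on_compose2[OF cont holomorphic_on_imp_continuous_on[OF hol]]) blast
    show "\<sigma> \<zeta> \<in> Y \<and> \<theta> (\<sigma> \<zeta>) = Re \<zeta>" if "\<zeta> \<in> ball (of_real (\<theta> q)) \<rho>" for \<zeta>
      using \<sigma>U(1)[OF that] U(1) covers bspec[OF k(3) gin(1)[OF that]] gin(2)[OF that] by (auto simp: \<sigma>_def d_def)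
    fix V \<psi> assume V: "(V, \<psi>) \<in> \<A>"
    have "(\<lambda>\<zeta>. g (\<zeta> + d)) holomorphic_on {\<zeta> \<in> ball (of_real (\<theta> q)) \<rho>. \<sigma> \<zeta> \<in> V}"
      using hol by (rule holomorphic_on_subset) auto
    moreover have "(\<psi> \<circ> inv_into U \<phi>) holomorphic_on \<phi> ` (U \<inter> V)"
      using compatible[OF U(1) V] .
    moreover have "(\<lambda>\<zeta>. g (\<zeta> + d)) ` {\<zeta> \<in> ball (of_real (\<theta> q)) \<rho>. \<sigma> \<zeta> \<in> V} \<subseteq> \<phi> ` (U \<inter> V)"
    proof clarify
      fix \<zeta> assume "\<zeta> \<in> ball (complex_of_real (\<theta> q)) \<rho>" "\<sigma> \<zeta> \<in> V"
      then show "g (\<zeta> + d) \<in> \<phi> ` (U \<inter> V)"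
        using \<sigma>U[of \<zeta>] by (metis IntI imageI)
    qed
    ultimately have "((\<psi> \<circ> inv_into U \<phi>) \<circ> (\<lambda>\<zeta>. g (\<zeta> + d))) holomorphic_on {\<zeta> \<in> ball (of_real (\<theta> q)) \<rho>. \<sigma> \<zeta> \<in> V}"
      using holomorphic_on_compose_gen by blast
    then show "(\<lambda>\<zeta>. \<psi> (\<sigma> \<zeta>)) holomorphic_on {\<zeta> \<in> ball (of_real (\<theta> q)) \<rho>. \<sigma> \<zeta> \<in> V}"
      by (simp add: o_def \<sigma>_def)
  qed
qed

text \<open>Over \<open>I\<close> the function \<open>\<eta>\<close> vanishes, and with
  \<open>e = exp (- Im \<zeta>)\<close> membership reduces to
  \<open>|e - \<omega>| < |\<omega>|\<close>, that is \<open>e < 2 * Re \<omega>\<close>. The bound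
  3/2 suffices because \<open>e \<le> exp 1 \<le> 3\<close>.\<close>

lemma holomorphic_disc_over_I:
  assumes cont: "continuous_on D \<sigma>"
    and \<sigma>: "\<And>x. x \<in> D \<Longrightarrow> \<sigma> x \<in> Y \<and> \<theta> (\<sigma> x) = Re x"
    and chart: "\<And>V \<psi>. (V, \<psi>) \<in> \<A> \<Longrightarrow> (\<lambda>x. \<psi> (\<sigma> x)) holomorphic_on {x \<in> D. \<sigma> x \<in> V}"
    and \<zeta>: "\<zeta> holomorphic_on ball 0 1"
    "\<And>u. u \<in> ball 0 1 \<Longrightarrow> \<zeta> u \<in> D \<and> Re (\<zeta> u) \<in> I \<and> \<bar>Im (\<zeta> u)\<bar> \<le> 1"
    and \<omega>: "\<omega> holomorphic_on ball 0 1" "\<And>u. u \<in> ball 0 1 \<Longrightarrow> 3 / 2 < Re (\<omega> u)"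
  shows "holomorphic_disc \<A> (worm_domain Y \<theta> \<eta>) (\<lambda>u. (\<sigma> (\<zeta> u), exp (\<i> * \<zeta> u) / \<omega> u))"
proof -
  have nz: "\<omega> u \<noteq> 0" if "u \<in> ball 0 1" for u
    using \<omega>(2)[OF that] by auto
  have inW: "(\<sigma> (\<zeta> u), exp (\<i> * \<zeta> u) / \<omega> u) \<in> worm_domain Y \<theta> \<eta>" if u: "u \<in> ball 0 1" for u
  proof -
    define e where "e = exp (- Im (\<zeta> u))"
    define X Y' where "X = Re (\<omega> u)" and "Y' = Im (\<omega> u)"
    have "e \<le> exp 1"
      using \<zeta>(2)[OF u] unfolding e_def exp_le_cancel_iff by linarith
    then have "e < 2 * X"
      using exp_le \<omega>(2)[OF u] unfolding X_def by linarith
    then have e: "0 < e" "e < 2 * X"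
      by (simp_all add: e_def)
    have X: "0 < X\<^sup>2 + Y'\<^sup>2"
      using e by (simp add: add_pos_nonneg)
    have "exp (\<i> * \<zeta> u) = of_real e * cis (Re (\<zeta> u))"
      by (simp add: exp_eq_polar e_def)
    then have "exp (\<i> * \<zeta> u) / \<omega> u - cis (Re (\<zeta> u)) = cis (Re (\<zeta> u)) * ((of_real e - \<omega> u) / \<omega> u)"
      using nz[OF u] by (simp add: diff_divide_distrib right_diff_distrib mult.commute)
    then have "(cmod (exp (\<i> * \<zeta> u) / \<omega> u - cis (Re (\<zeta> u))))\<^sup>2 = (cmod (of_real e - \<omega> u))\<^sup>2 / (cmod (\<omega> u))\<^sup>2"
      by (simp add: norm_mult norm_divide power_divide)
    also have "\<dots> = ((e - X)\<^sup>2 + Y'\<^sup>2) / (X\<^sup>2 + Y'\<^sup>2)"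
      by (simp add: cmod_power2 X_def Y'_def)
    also have "\<dots> < 1"
    proof -
      have "e * e < e * (2 * X)"
        using e by (intro mult_strict_left_mono) auto
      then show ?thesis
        using X by (simp add: power2_eq_square algebra_simps)
    qed
    finally show ?thesis
      using \<sigma>[of "\<zeta> u"] \<zeta>(2)[OF u] eta_zero by (simp add: worm_domain_def cis_conv_exp)
  qed
  have contd: "continuous_on (ball 0 1) (\<lambda>u. \<sigma> (\<zeta> u))"
    using \<zeta>(2) by (intro continuous_on_compose2[OF cont holomorphic_on_imp_continuous_on[OF \<zeta>(1)]]) auto
  have hol: "(\<lambda>u. exp (\<i> * \<zeta> u) / \<omega> u) holomorphic_on ball 0 1"
    using nz by (intro holomorphic_intros \<zeta> \<omega>) auto
  have "\<forall>(V, \<psi>)\<in>\<A>. (\<lambda>u. \<psi> (\<sigma> (\<zeta> u))) holomorphic_on {u \<in> ball 0 1. \<sigma> (\<zeta> u) \<in> V}"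
  proof clarify
    fix V \<psi> assume V: "(V, \<psi>) \<in> \<A>"
    have "\<zeta> holomorphic_on {u \<in> ball 0 1. \<sigma> (\<zeta> u) \<in> V}"
      using \<zeta>(1) by (rule holomorphic_on_subset) auto
    then have "((\<lambda>x. \<psi> (\<sigma> x)) \<circ> \<zeta>) holomorphic_on {u \<in> ball 0 1. \<sigma> (\<zeta> u) \<in> V}"
      by (rule holomorphic_on_compose_gen[OF _ chart[OF V]]) (use \<zeta>(2) in auto)
    then show "(\<lambda>u. \<psi> (\<sigma> (\<zeta> u))) holomorphic_on {u \<in> ball 0 1. \<sigma> (\<zeta> u) \<in> V}"
      by (simp only: o_def)
  qed
  moreover have "continuous_on (ball 0 1) (\<lambda>u. (\<sigma> (\<zeta> u), exp (\<i> * \<zeta> u) / \<omega> u))"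
    using contd holomorphic_on_imp_continuous_on[OF hol] by (rule continuous_on_Pair)
  moreover have "(\<lambda>u. (\<sigma> (\<zeta> u), exp (\<i> * \<zeta> u) / \<omega> u)) ` ball 0 1 \<subseteq> worm_domain Y \<theta> \<eta>"
    using inW by blast
  ultimately show ?thesis
    unfolding holomorphic_disc_def fst_conv snd_conv using hol by blast
qed

section \<open>The square with long diagonals\<close>

text \<open>The points \<open>x\<close>, \<open>y\<close> are opposite vertices in the disc factor,
  and their distance is bounded by the height estimate. The points \<open>z\<close>,
  \<open>p\<close> are opposite in the half-plane factor, and there the argument estimate is
  used.\<close>

lemma Kobayashi_quadrilateral:
  assumes N: "0 < N"
  defines "d \<equiv> kobayashi_dist \<A> (worm_domain Y \<theta> \<eta>)"
  obtains x y z p where "{x, y, z, p} \<subseteq> worm_domain Y \<theta> \<eta>"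
    "d x z \<le> N" "d x p \<le> N" "d y z \<le> N" "d y p \<le> N" "N / 2 - 1 \<le> d x y" "2 * N - 1 \<le> d z p"
proof -
  let ?W = "worm_domain Y \<theta> \<eta>"
  define T where "T = tanh N"
  have T: "0 < T" "T < 1" "artanh T = N"
    using N by (auto simp: T_def artanh_tanh_real tanh_real_lt_1)
  obtain a b where I: "a < b" "I = {a..b}"
    by (rule I_endpoints)
  have "b \<in> J"
    using I I_sub_J interior_subset by fastforce
  then obtain q where q: "q \<in> Y" "\<theta> q = b"
    by (rule theta_attains)
  have "\<not> critical_point \<A> \<theta> q"
    using theta_regular[OF q(1)] I q(2) by (simp add: frontier_def)
  then obtain \<rho> \<sigma> where \<rho>: "\<rho> > 0" and cont: "continuous_on (ball (of_real b) \<rho>) \<sigma>"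
    and \<sigma>: "\<And>x. x \<in> ball (of_real b) \<rho> \<Longrightarrow> \<sigma> x \<in> Y \<and> \<theta> (\<sigma> x) = Re x"
    and chart: "\<And>V \<psi>. (V, \<psi>) \<in> \<A> \<Longrightarrow> (\<lambda>x. \<psi> (\<sigma> x)) holomorphic_on {x \<in> ball (of_real b) \<rho>. \<sigma> x \<in> V}"
    using conformal_parametrization[OF q(1), unfolded q(2)] by metis
  \<comment> \<open>The disc of radius \<open>r\<close> about \<open>b - r\<close> then lies in the
    domain of \<open>\<sigma>\<close> and over \<open>I\<close>, with imaginary parts at most
    1.\<close>
  define r where "r = min (min (\<rho> / 2) ((b - a) / 2)) 1"
  have r: "0 < r" "2 * r \<le> \<rho>" "2 * r \<le> b - a" "r \<le> 1"
    using \<rho> I(1) unfolding r_def by (simp_all add: min_def)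
  \<comment> \<open>\<open>B\<close> exceeds \<open>b\<close> by as much as \<open>\<theta>\<close>
    at \<open>y\<close> falls short of it. So \<open>B - \<theta>\<close> is \<open>2 * r\<close> at
    \<open>x\<close> and \<open>2 * r * (1 - T)\<close> at \<open>y\<close>, and the logarithm of
    the ratio is \<open>2 * N - ln (1 + T)\<close>.\<close>
  define B where "B = b + r * (1 - T)"
  have "b < B"
    using r T by (simp add: B_def)
  then obtain \<kappa>0 where \<kappa>0: "\<kappa>0 > 0" "\<And>x. B \<le> x \<Longrightarrow> \<kappa>0 \<le> \<eta> x"
    using eta_lower_bound[OF I(2,1)] by metis
  define \<kappa> where "\<kappa> = min 1 (\<kappa>0 / 2)"
  have \<kappa>: "0 < \<kappa>" "\<kappa> \<le> 1"
    using \<kappa>0 by (auto simp: \<kappa>_def)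
  have low: "\<theta> z < B" if "(z, w) \<in> ?W" "cmod w \<le> \<kappa>" for z w
    using worm_domain_point(6)[OF that(1)] that(2) \<kappa>0(2)[of "\<theta> z"] by (force simp: \<kappa>_def)
  \<comment> \<open>Up to sign this is \<open>arsinh\<close> of the slope of \<open>\<omega>\<close>
    at \<open>z\<close> and \<open>p\<close>. As \<open>R\<close> grows, the offset 3/2 of the
    half-plane becomes negligible and the value tends to \<open>2 * N\<close>.\<close>
  define g where "g R = arsinh (2 * T / (3 / 2 * (1 + T\<^sup>2) / R + (1 - T\<^sup>2)))" for R
  have T2: "1 - T\<^sup>2 > 0"
    using T by (simp add: power_less_one_iff)
  have "arsinh (2 * T / (1 - T\<^sup>2)) = 2 * N"
  proof -
    have "sinh (2 * N) = 2 * T / (1 - T\<^sup>2)"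
    proof -
      have c: "cosh N \<noteq> 0"
        by (simp add: cosh_real_nonzero)
      have "1 - T\<^sup>2 = ((cosh N)\<^sup>2 - (sinh N)\<^sup>2) / (cosh N)\<^sup>2"
        using c by (simp add: T_def tanh_def power_divide diff_divide_distrib)
      then have "1 - T\<^sup>2 = 1 / (cosh N)\<^sup>2"
        by (simp add: hyperbolic_pythagoras)
      then show ?thesis
        using c by (simp add: sinh_double T_def tanh_def power2_eq_square)
    qed
    then show ?thesis
      by (metis arsinh_sinh_real)
  qed
  moreover have "((\<lambda>R. 2 * T / (3 / 2 * (1 + T\<^sup>2) / R + (1 - T\<^sup>2))) \<longlongrightarrow> 2 * T / (0 + (1 - T\<^sup>2))) at_top"
    using T2 by (intro tendsto_intros tendsto_divide_0[OF tendsto_const] filterlim_at_top_imp_at_infinity filterlim_ident) auto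
  then have "(g \<longlongrightarrow> arsinh (2 * T / (0 + (1 - T\<^sup>2)))) at_top"
    unfolding g_def by (rule isCont_tendsto_compose[OF isCont_arsinh])
  ultimately have "(g \<longlongrightarrow> 2 * N) at_top"
    by simp
  then have "eventually (\<lambda>R. 2 * N - 1 < g R) at_top"
    by (rule order_tendstoD) simp
  \<comment> \<open>For \<open>R > exp K\<close> the modulus of \<open>w\<close> at \<open>x\<close>
    is small enough for \<open>disc_chain_height\<close> with \<open>L = N\<close>.\<close>
  moreover define K where "K = 4 * exp (4 * N) * ln (2 / \<kappa>)"
  have "eventually (\<lambda>R. exp K < R) at_top"
    by (rule eventually_gt_at_top)
  ultimately have "eventually (\<lambda>R. 2 * N - 1 < g R \<and> exp K < R) at_top"
    by (rule eventually_conj)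
  then obtain R where R: "2 * N - 1 < g R" "exp K < R"
    using eventually_happens'[OF trivial_limit_at_top_linorder] by blast
  have R0: "R > 0"
    using R(2) exp_gt_zero[of K] by linarith
  \<comment> \<open>\<open>\<zeta>\<close> maps the unit disc onto the disc tangent to
    \<open>Re = b\<close> at \<open>b\<close>, and \<open>\<omega>\<close> maps it onto the
    half-plane \<open>Re > 3 / 2\<close>, with real \<open>t\<close> going to the half circle of
    radius \<open>R\<close> about 3/2.\<close>
  define \<zeta> where "\<zeta> s = of_real b - of_real r * (1 - s)" for s :: complex
  define \<omega> where "\<omega> t = 3 / 2 + of_real R * ((1 + \<i> * t) / (1 - \<i> * t))" for t :: complex
  define P where "P s t = (\<sigma> (\<zeta> s), exp (\<i> * \<zeta> s) / \<omega> t)" for s t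
  have \<zeta>: "\<zeta> s \<in> ball (of_real b) \<rho> \<and> Re (\<zeta> s) \<in> I \<and> \<bar>Im (\<zeta> s)\<bar> \<le> 1" if "cmod s < 1" for s
  proof (intro conjI)
    have "cmod (1 - s) < 2"
      using norm_triangle_ineq4[of 1 s] that by simp
    then have "r * cmod (1 - s) < r * 2"
      using r by (intro mult_strict_left_mono)
    moreover have "dist (of_real b) (\<zeta> s) = r * cmod (1 - s)"
      using r by (simp add: \<zeta>_def dist_norm norm_mult)
    ultimately show "\<zeta> s \<in> ball (of_real b) \<rho>"
      unfolding mem_ball using r(2) by linarith
    have "\<bar>Re s\<bar> < 1" "\<bar>Im s\<bar> < 1"
      using abs_Re_le_cmod[of s] abs_Im_le_cmod[of s] that by linarith+
    then have "r * (1 - Re s) \<le> r * 2" "0 \<le> r * (1 - Re s)" "r * \<bar>Im s\<bar> \<le> 1 * 1"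
      using r by (intro mult_left_mono mult_nonneg_nonneg mult_mono; simp)+
    moreover have "Re (\<zeta> s) = b - r * (1 - Re s)" "\<bar>Im (\<zeta> s)\<bar> = r * \<bar>Im s\<bar>"
      using r by (simp_all add: \<zeta>_def abs_mult)
    ultimately show "Re (\<zeta> s) \<in> I" "\<bar>Im (\<zeta> s)\<bar> \<le> 1"
      unfolding I atLeastAtMost_iff using r(3) by linarith+
  qed
  have nz: "1 - \<i> * t \<noteq> 0" if "cmod t < 1" for t
    using that by (metis eq_iff_diff_eq_0 norm_ii norm_mult norm_one less_irrefl mult_1)
  have \<omega>: "3 / 2 < Re (\<omega> t)" if "cmod t < 1" for t
  proof -
    have "0 < 1 - (cmod t)\<^sup>2"
      using that by (simp add: power_less_one_iff)
    moreover define v where "v = (1 + \<i> * t) / (1 - \<i> * t)"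
    have "Re v = (1 - (cmod t)\<^sup>2) / (cmod (1 - \<i> * t))\<^sup>2"
      unfolding v_def by (simp add: Re_divide cmod_power2) (simp add: power2_eq_square algebra_simps)
    ultimately have "0 < R * Re v"
      using nz[OF that] R0 by simp
    moreover have "\<omega> t = 3 / 2 + of_real R * v"
      by (simp add: \<omega>_def v_def)
    ultimately show ?thesis
      by simp
  qed
  have disc: "holomorphic_disc \<A> ?W (\<lambda>u. P (S u) (V u))"
    if S: "S holomorphic_on ball 0 1" "\<And>u. cmod u < 1 \<Longrightarrow> cmod (S u) < 1"
      and V: "V holomorphic_on ball 0 1" "\<And>u. cmod u < 1 \<Longrightarrow> cmod (V u) < 1" for S V
    unfolding P_def
  proof (rule holomorphic_disc_over_I[OF cont \<sigma> chart])
    show "(\<lambda>u. \<zeta> (S u)) holomorphic_on ball 0 1"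
      unfolding \<zeta>_def by (intro holomorphic_intros S)
    show "(\<lambda>u. \<omega> (V u)) holomorphic_on ball 0 1"
      unfolding \<omega>_def using nz V by (intro holomorphic_intros) auto
    show "\<zeta> (S u) \<in> ball (of_real b) \<rho> \<and> Re (\<zeta> (S u)) \<in> I \<and> \<bar>Im (\<zeta> (S u))\<bar> \<le> 1" if "u \<in> ball 0 1" for u
      using \<zeta> S that by simp
    show "3 / 2 < Re (\<omega> (V u))" if "u \<in> ball 0 1" for u
      using \<omega> V that by simp
  qed
  have cT: "cmod (of_real T) = T" "cmod (of_real T) < 1"
    using T by auto
  have cross: "d (P (\<epsilon> * of_real T) 0) (P 0 (\<epsilon>' * of_real T)) \<le> N" if "cmod \<epsilon> = 1" "cmod \<epsilon>' = 1" for \<epsilon> \<epsilon>'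
  proof -
    \<comment> \<open>A single disc moves in both factors at once: it passes through
      \<open>P (\<epsilon> * T) 0\<close> at \<open>u = 0\<close> and through
      \<open>P 0 (\<epsilon>' * T)\<close> at \<open>u = T\<close>.\<close>
    define S where "S u = - \<epsilon> * Moebius_function 0 (of_real T) u" for u
    have "holomorphic_disc \<A> ?W (\<lambda>u. P (S u) (\<epsilon>' * u))"
    proof (rule disc)
      show "S holomorphic_on ball 0 1"
        unfolding S_def by (intro holomorphic_intros Moebius_function_holomorphic cT)
      show "cmod (S u) < 1" if "cmod u < 1" for u
        using Moebius_function_norm_lt_1[OF cT(2) that] \<open>cmod \<epsilon> = 1\<close> by (simp add: S_def norm_mult)
    qed (use that in \<open>auto simp: norm_mult intro!: holomorphic_intros\<close>)
    then have "d (P (S 0) (\<epsilon>' * 0)) (P (S (of_real T)) (\<epsilon>' * of_real T)) \<le> poincare_dist 0 (of_real T)"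
      unfolding d_def using T by (intro kobayashi_dist_le) auto
    then show ?thesis
      using T by (simp add: S_def Moebius_function_simple poincare_dist_def)
  qed
  define x y z p where "x = P (- of_real T) 0" and "y = P (of_real T) 0" and "z = P 0 (of_real T)"
    and "p = P 0 (- of_real T)"
  have discs: "holomorphic_disc \<A> ?W (\<lambda>u. P u 0)" "holomorphic_disc \<A> ?W (\<lambda>u. P 0 u)"
    by (rule disc; auto intro: holomorphic_intros)+
  have Tball: "of_real T \<in> ball (0 :: complex) 1" "- of_real T \<in> ball (0 :: complex) 1"
    using T by auto
  have \<theta>P: "\<theta> (fst (P (of_real s) t)) = b - r * (1 - s)" if "\<bar>s\<bar> < 1" for s t
    using \<sigma>[of "\<zeta> (of_real s)"] \<zeta>[of "of_real s"] that by (simp add: P_def) (simp add: \<zeta>_def)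
  have xy: "N / 2 - 1 \<le> d x y"
    unfolding d_def
  proof (rule kobayashi_dist_ge)
    show "disc_chain \<A> ?W x y (poincare_dist (- of_real T) (of_real T))"
      using disc_chain_disc[OF discs(1) Tball(2,1)] by (simp add: x_def y_def)
    fix l assume l: "disc_chain \<A> ?W x y l"
    \<comment> \<open>Only chains of length at most \<open>N\<close> need the height estimate;
      longer ones satisfy the bound anyway.\<close>
    show "N / 2 - 1 \<le> l"
    proof (cases "l \<le> N")
      case True
      have "exp (\<i> * \<zeta> (- of_real T)) = cis (b - r * (1 + T))"
        by (simp add: \<zeta>_def cis_conv_exp)
      moreover have "\<omega> 0 = of_real (3 / 2 + R)"
        by (simp add: \<omega>_def)
      ultimately have "cmod (snd x) = 1 / cmod (complex_of_real (3 / 2 + R))"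
        by (simp add: x_def P_def norm_divide del: of_real_add)
      also have "\<dots> = 1 / (3 / 2 + R)"
        using R0 by (simp only: norm_of_real)
      finally have "cmod (snd x) = 1 / (3 / 2 + R)" .
      then have "ln (2 / cmod (snd x)) = ln (3 + 2 * R)"
        by simp
      moreover have "K \<le> ln (3 + 2 * R)"
        using R(2) R0 by (subst ln_ge_iff) auto
      ultimately have "\<bar>ln (B - \<theta> (fst y)) - ln (B - \<theta> (fst x))\<bar> \<le> 4 * l"
        using disc_chain_height[OF l True \<kappa> low] by (simp add: K_def)
      moreover have "B - \<theta> (fst y) = 2 * r * (1 - T)" "B - \<theta> (fst x) = 2 * r"
        using \<theta>P[of T 0] \<theta>P[of "- T" 0] T by (auto simp: x_def y_def B_def algebra_simps)
      ultimately have "- ln (1 - T) \<le> 4 * l"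
        using r T by (simp add: ln_mult)
      moreover have "2 * N = ln (1 + T) - ln (1 - T)"
        using T by (simp add: artanh_def ln_div)
      moreover have "ln (1 + T) \<le> T"
        using T by (intro ln_add_one_self_le_self) auto
      ultimately show ?thesis
        using T by linarith
    qed (use N in linarith)
  qed
  have zp: "2 * N - 1 \<le> d z p"
    unfolding d_def
  proof (rule kobayashi_dist_ge)
    show "disc_chain \<A> ?W z p (poincare_dist (of_real T) (- of_real T))"
      using disc_chain_disc[OF discs(2) Tball] by (simp add: z_def p_def)
    fix l assume l: "disc_chain \<A> ?W z p l"
    define \<alpha> where "\<alpha> p = arsinh (Im (snd p * cis (- \<theta> (fst p))) / Re (snd p * cis (- \<theta> (fst p))))" for p :: "'a \<times> complex"
    have \<alpha>: "\<alpha> (P 0 (of_real t)) = - arsinh (2 * t / (3 / 2 * (1 + t\<^sup>2) / R + (1 - t\<^sup>2)))" for t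
    proof -
      have "exp (\<i> * \<zeta> 0) = cis (b - r)"
        by (simp add: \<zeta>_def cis_conv_exp)
      then have *: "snd (P 0 (of_real t)) * cis (- \<theta> (fst (P 0 (of_real t)))) = 1 / \<omega> (of_real t)"
        using \<theta>P[of 0 "of_real t"] by (simp add: P_def cis_mult)
      \<comment> \<open>The rotated \<open>w\<close> is \<open>1 / \<omega>\<close>, and inversion
        only changes the sign of the slope.\<close>
      have ImRe: "Im (1 / v) / Re (1 / v) = - (Im v / Re v)" for v :: complex
        by (cases "v = 0") (auto simp: Re_divide Im_divide complex_neq_0)
      have scale: "(R * c / m) / (3 / 2 + R * n / m) = c / (3 / 2 * m / R + n)" if "0 < m" for c m n :: real
      proof -
        have "3 / 2 + R * n / m = R / m * (3 / 2 * m / R + n)"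
          using that R0 by (simp add: field_simps)
        moreover have "R * c / m = R / m * c"
          by simp
        ultimately show ?thesis
          using that R0 by (simp only: mult_divide_mult_cancel_left_if) auto
      qed
      have t: "0 < 1 + t\<^sup>2"
        by (simp add: add_pos_nonneg)
      have "\<omega> (of_real t) = Complex (3 / 2 + R * (1 - t\<^sup>2) / (1 + t\<^sup>2)) (R * (2 * t) / (1 + t\<^sup>2))"
        by (simp add: \<omega>_def complex_eq_iff Re_divide Im_divide power2_eq_square) (simp add: algebra_simps)
      then have "Im (\<omega> (of_real t)) / Re (\<omega> (of_real t)) = (R * (2 * t) / (1 + t\<^sup>2)) / (3 / 2 + R * (1 - t\<^sup>2) / (1 + t\<^sup>2))"
        by simp
      also have "\<dots> = 2 * t / (3 / 2 * (1 + t\<^sup>2) / R + (1 - t\<^sup>2))"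
        by (rule scale[OF t])
      finally show ?thesis
        unfolding \<alpha>_def * ImRe by simp
    qed
    have "\<bar>\<alpha> p - \<alpha> z\<bar> \<le> 2 * l"
      using disc_chain_argument[OF l] by (simp add: \<alpha>_def)
    \<comment> \<open>The values are opposite, so they differ by \<open>2 * g R\<close>, and the
      factor 2 of \<open>disc_chain_argument\<close> cancels.\<close>
    moreover have "\<alpha> z = - g R" "\<alpha> p = g R"
      using \<alpha>[of T] \<alpha>[of "- T"] by (auto simp: z_def p_def g_def)
    ultimately show "2 * N - 1 \<le> l"
      using R(1) by linarith
  qed
  show thesis
  proof (rule that[of x y z p])
    show "{x, y, z, p} \<subseteq> ?W"
      using holomorphic_disc_in[OF discs(1)] holomorphic_disc_in[OF discs(2)] Tball
      by (simp add: x_def y_def z_def p_def)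
    show "d x z \<le> N" "d x p \<le> N" "d y z \<le> N" "d y p \<le> N"
      using cross[of "-1" 1] cross[of "-1" "-1"] cross[of 1 1] cross[of 1 "-1"]
      by (simp_all add: x_def y_def z_def p_def)
  qed (fact xy zp)+
qed

end

theorem theorem1:
  fixes Y :: "'a::t2_space set" and \<A> :: "'a chart set"
    and \<theta> :: "'a \<Rightarrow> real" and \<eta> :: "real \<Rightarrow> real" and I J :: "real set"
    and W :: "('a \<times> complex) set"
  assumes "worm Y \<A> \<theta> \<eta> I J"
    and "W = worm_domain Y \<theta> \<eta>"
  shows "\<not> gromov_hyperbolic W (kobayashi_dist \<A> W)"
proof
  interpret worm Y \<A> \<theta> \<eta> I J
    by fact
  let ?d = "kobayashi_dist \<A> W"
  assume "gromov_hyperbolic W ?d"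
  then obtain \<delta> where \<delta>: "\<delta> \<ge> 0" and hyp: "\<And>x y z p. x \<in> W \<Longrightarrow> y \<in> W \<Longrightarrow> z \<in> W \<Longrightarrow> p \<in> W \<Longrightarrow>
      min (gromov_product ?d x z p) (gromov_product ?d y z p) - \<delta> \<le> gromov_product ?d x y p"
    unfolding gromov_hyperbolic_def by blast
  \<comment> \<open>The square will give \<open>N / 2 \<le> 2 * \<delta> + 2\<close>, whereas here
    \<open>N / 2 = 2 * \<delta> + 5 / 2\<close>.\<close>
  define N where "N = 4 * \<delta> + 5"
  have "0 < N"
    using \<delta> by (simp add: N_def)
  then obtain x y z p where W: "{x, y, z, p} \<subseteq> W"
    and d: "?d x z \<le> N" "?d x p \<le> N" "?d y z \<le> N" "?d y p \<le> N" "N / 2 - 1 \<le> ?d x y" "2 * N - 1 \<le> ?d z p"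
    unfolding assms(2) by (rule Kobayashi_quadrilateral)
  have "?d x y + ?d z p \<le> max (?d x z + ?d y p) (?d y z + ?d x p) + 2 * \<delta>"
    using W by (intro gromov_product_four_point hyp) auto
  then have "N / 2 \<le> 2 * \<delta> + 2"
    using d by linarith
  then show False
    by (simp add: N_def)
qed

end
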